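(* Let $\mu$ be a regular cardinal, let $\mathcal{K}$ be a $\mu$-AEC, and let $\lambda$ be a cardinal with $\lambda = \lambda^{<\mu} \ge \mathrm{LS}(\mathcal{K})$ such that $I(\lambda,\mathcal{K}) = 1 \le I(\lambda^+,\mathcal{K}) < 2^{\lambda^+}$. Suppose moreover that: (1) $\mathcal{K}_\lambda$ has the $\delta$-chain extension property for every $\delta < \lambda^+$; (2) $\lambda = \lambda^{\mu}$ and $2^\lambda = \lambda^+$. Then $\mathcal{K}$ has $\lambda$-amalgamation.
   Context: For an infinite cardinal $\mu$, a $\mu$-ary language $L$ consists of function and relation symbols, each with an arity that is an ordinal $<\mu$. A $\mu$-abstract class is a pair $(\mathcal{K}, \le_{\mathcal{K}})$ where $\mathcal{K}$ is a class of $L$-structures for a fixed $\mu$-ary language $L = L(\mathcal{K})$, $\le_{\mathcal{K}}$ is a reflexive and transitive relation on $\mathcal{K}$ such that $M \le_{\mathcal{K}} N$ implies $M$ is an $L$-substructure of $N$, and which respects isomorphisms (if $f: N \cong N'$ and $N \in \mathcal{K}$ then $N' \in \mathcal{K}$, and if moreover $M \le_{\mathcal{K}} N$ then $f[M] \in \mathcal{K}$ and $f[M] \le_{\mathcal{K}} N'$). A poset $I$ is $\mu$-directed if every subset of size $<\mu$ has an upper bound. For $\mu$ regular, a $\mu$-abstract class is a $\mu$-AEC if: (Coherence) if $M_0, M_1, M_2 \in \mathcal{K}$, $M_0 \le_{\mathcal{K}} M_2$, $M_1 \le_{\mathcal{K}} M_2$ and $M_0 \subseteq M_1$, then $M_0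 \le_{\mathcal{K}} M_1$; (Tarski–Vaught) if $\{M_i : i \in I\} \subseteq \mathcal{K}$ with $I$ $\mu$-directed and $i \le j \Rightarrow M_i \le_{\mathcal{K}} M_j$, then (a) $\bigcup_i M_i \in \mathcal{K}$ and $M_j \le_{\mathcal{K}} \bigcup_i M_i$ for all $j$, and (b) if $N \in \mathcal{K}$ with $M_i \le_{\mathcal{K}} N$ for all $i$, then $\bigcup_i M_i \le_{\mathcal{K}} N$; (Löwenheim–Skolem–Tarski) there is a cardinal $\lambda = \lambda^{<\mu} \ge |L(\mathcal{K})| + \mu$ such that for every $M \in \mathcal{K}$ and $A \subseteq |M|$ there is $N \le_{\mathcal{K}} M$ with $A \subseteq |N|$ and $|N| \le |A|^{<\mu} + \lambda$; $\mathrm{LS}(\mathcal{K})$ is the least such $\lambda$. $I(\chi,\mathcal{K})$ is the number of pairwise non-isomorphic models in $\mathcal{K}$ of cardinality $\chi$. $\mathcal{K}_\lambda$ is the class of models in $\mathcal{K}$ of cardinality $\lambda$, with the restriction of $\le_{\mathcal{K}}$. For an ordinal $\delta$, $\mathcal{K}_\lambda$ has the $\delta$-chain extension property if for every $\le_{\mathcal{K}}$-increasing chain $\langle M_i : i<\delta\rangle$ in $\mathcal{K}_\lambda$ there is $M_\delta \in \mathcal{K}_\lambda$ with $M_i \le_{\mathcal{K}} M_\delta$ for all $i<\delta$. A $\mathcal{K}$-embedding $g: M \to N$ is an $L$-isomorphism from $M$ onto some $g[M] \le_{\mathcal{K}} N$. $\mathcal{K}$ has $\lambda$-amalgamation if whenever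 $M_0, M_1, M_2 \in \mathcal{K}_\lambda$ with $M_0 \le_{\mathcal{K}} M_1$ and $M_0 \le_{\mathcal{K}} M_2$, there are $N \in \mathcal{K}_\lambda$ and $\mathcal{K}$-embeddings $g_\ell: M_\ell \to N$ ($\ell = 1,2$) with $g_1 \upharpoonright M_0 = g_2 \upharpoonright M_0$. *)

theory Defs
  imports Main "HOL-Library.FuncSet"
begin

unbundle cardinal_syntax

text \<open>
  Cardinals are \<^const>\<open>Card_order\<close> relations, compared across types by \<open>\<le>o\<close>, \<open><o\<close> and \<open>=o\<close>.
  For a cardinal \<open>\<mu>\<close>, the ordinals below \<open>\<mu>\<close> are the elements \<open>a\<close> of \<open>Field \<mu>\<close>, where \<open>a\<close> stands
  for the order type of its set \<open>underS \<mu> a\<close> of strict predecessors.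
\<close>

text \<open>
  \<open>cpow_less \<kappa> \<mu>\<close> is \<open>\<kappa>\<close> to the power \<open><\<mu>\<close>: the number of sequences in \<open>\<kappa>\<close> of length below \<open>\<mu>\<close>.
  The union over the lengths is made disjoint because two distinct functions on \<open>underS \<mu> a\<close> and
  \<open>underS \<mu> b\<close> may be represented by the same total function of HOL.
\<close>

definition cpow_less :: "'k rel \<Rightarrow> 'm rel \<Rightarrow> ('m \<times> ('m \<Rightarrow> 'k)) rel" where
  "cpow_less \<kappa> \<mu> = |SIGMA a : Field \<mu>. underS \<mu> a \<rightarrow>\<^sub>E Field \<kappa>|"


section \<open>Structures for a \<open>\<mu>\<close>-ary language\<close>

record ('f, 'r, 'm) lang =
  fsyms :: "'f set"
  rsyms :: "'r set"
  farity :: "'f \<Rightarrow> 'm"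
  rarity :: "'r \<Rightarrow> 'm"

definition lang_ary :: "'m rel \<Rightarrow> ('f, 'r, 'm) lang \<Rightarrow> bool" where
  "lang_ary \<mu> L \<longleftrightarrow> farity L ` fsyms L \<subseteq> Field \<mu> \<and> rarity L ` rsyms L \<subseteq> Field \<mu>"

record ('a, 'f, 'r, 'm) struc =
  univ :: "'a set"
  fn :: "'f \<Rightarrow> ('m \<Rightarrow> 'a) \<Rightarrow> 'a"
  rl :: "'r \<Rightarrow> ('m \<Rightarrow> 'a) set"

definition tuples :: "'m rel \<Rightarrow> 'm \<Rightarrow> 'a set \<Rightarrow> ('m \<Rightarrow> 'a) set" where
  "tuples \<mu> a A = underS \<mu> a \<rightarrow>\<^sub>E A"

definition map_tuple :: "'m rel \<Rightarrow> 'm \<Rightarrow> ('a \<Rightarrow> 'b) \<Rightarrow> ('m \<Rightarrow> 'a) \<Rightarrow> ('m \<Rightarrow> 'b)" where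
  "map_tuple \<mu> a h x = (\<lambda>i\<in>underS \<mu> a. h (x i))"

text \<open>
  Interpretations are required to be extensional, so that two structures with the same universe and
  the same interpretations are equal.
\<close>

definition is_struc :: "'m rel \<Rightarrow> ('f, 'r, 'm) lang \<Rightarrow> ('a, 'f, 'r, 'm) struc \<Rightarrow> bool" where
  "is_struc \<mu> L M \<longleftrightarrow>
     fn M \<in> (\<Pi>\<^sub>E F\<in>fsyms L. tuples \<mu> (farity L F) (univ M) \<rightarrow>\<^sub>E univ M) \<and>
     rl M \<in> (\<Pi>\<^sub>E R\<in>rsyms L. Pow (tuples \<mu> (rarity L R) (univ M)))"

definition substruc ::
  "'m rel \<Rightarrow> ('f, 'r, 'm) lang \<Rightarrow> ('a, 'f, 'r, 'm) struc \<Rightarrow> ('a, 'f, 'r, 'm) struc \<Rightarrow> bool" where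
  "substruc \<mu> L M N \<longleftrightarrow> is_struc \<mu> L M \<and> is_struc \<mu> L N \<and> univ M \<subseteq> univ N \<and>
     (\<forall>F\<in>fsyms L. \<forall>x\<in>tuples \<mu> (farity L F) (univ M). fn M F x = fn N F x) \<and>
     (\<forall>R\<in>rsyms L. rl M R = rl N R \<inter> tuples \<mu> (rarity L R) (univ M))"

definition iso ::
  "'m rel \<Rightarrow> ('f, 'r, 'm) lang \<Rightarrow> ('a \<Rightarrow> 'a) \<Rightarrow> ('a, 'f, 'r, 'm) struc \<Rightarrow> ('a, 'f, 'r, 'm) struc \<Rightarrow> bool"
  where
  "iso \<mu> L h M N \<longleftrightarrow> is_struc \<mu> L M \<and> is_struc \<mu> L N \<and> bij_betw h (univ M) (univ N) \<and>
     (\<forall>F\<in>fsyms L. \<forall>x\<in>tuples \<mu> (farity L F) (univ M).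
        h (fn M F x) = fn N F (map_tuple \<mu> (farity L F) h x)) \<and>
     (\<forall>R\<in>rsyms L. \<forall>x\<in>tuples \<mu> (rarity L R) (univ M).
        x \<in> rl M R \<longleftrightarrow> map_tuple \<mu> (rarity L R) h x \<in> rl N R)"

text \<open>
  The union of a \<open>\<mu>\<close>-directed system of structures. For \<open>\<mu>\<close> regular every tuple of the union is a
  tuple of some member of the system, and the value of a function symbol at it does not depend on
  the member chosen.
\<close>

definition union_struc ::
  "'m rel \<Rightarrow> ('f, 'r, 'm) lang \<Rightarrow> 'i set \<Rightarrow> ('i \<Rightarrow> ('a, 'f, 'r, 'm) struc) \<Rightarrow> ('a, 'f, 'r, 'm) struc"
  where
  "union_struc \<mu> L I M =
     \<lparr>univ = (\<Union>i\<in>I. univ (M i)),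
      fn = (\<lambda>F\<in>fsyms L. \<lambda>x\<in>tuples \<mu> (farity L F) (\<Union>i\<in>I. univ (M i)).
              THE y. \<exists>i\<in>I. x \<in> tuples \<mu> (farity L F) (univ (M i)) \<and> y = fn (M i) F x),
      rl = (\<lambda>R\<in>rsyms L. \<Union>i\<in>I. rl (M i) R)\<rparr>"


section \<open>\<open>\<mu>\<close>-abstract classes and \<open>\<mu>\<close>-AECs\<close>

text \<open>
  A class of structures is a set of structures whose universes are subsets of one type \<open>'a\<close>; nothing
  is assumed about the size of that type. A proper class and its restriction to structures living in
  \<open>'a\<close> have, up to isomorphism, the same models of every cardinality at most the cardinality
  of \<open>'a\<close>.
\<close>

record ('a, 'f, 'r, 'm) aclass =
  Lang :: "('f, 'r, 'm) lang"
  Mod :: "('a, 'f, 'r, 'm) struc set"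
  Le :: "('a, 'f, 'r, 'm) struc rel"

text \<open>
  The image \<open>f[M]\<close> of \<open>M\<close> under a map injective on its universe is the unique structure \<open>M'\<close>
  with \<open>iso \<mu> L f M M'\<close>.
\<close>

definition mu_abstract_class :: "'m rel \<Rightarrow> ('a, 'f, 'r, 'm) aclass \<Rightarrow> bool" where
  "mu_abstract_class \<mu> K \<longleftrightarrow>
     lang_ary \<mu> (Lang K) \<and>
     (\<forall>M\<in>Mod K. is_struc \<mu> (Lang K) M) \<and>
     preorder_on (Mod K) (Le K) \<and>
     (\<forall>(M, N)\<in>Le K. substruc \<mu> (Lang K) M N) \<and>
     (\<forall>f N N'. N \<in> Mod K \<and> iso \<mu> (Lang K) f N N' \<longrightarrow>
        N' \<in> Mod K \<and>
        (\<forall>M. (M, N) \<in> Le K \<longrightarrow>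
           (\<exists>M'. iso \<mu> (Lang K) f M M' \<and> M' \<in> Mod K \<and> (M', N') \<in> Le K)))"

definition mu_directed :: "'m rel \<Rightarrow> 'i set \<Rightarrow> 'i rel \<Rightarrow> bool" where
  "mu_directed \<mu> I r \<longleftrightarrow> partial_order_on I r \<and>
     (\<forall>S\<subseteq>I. |S| <o \<mu> \<longrightarrow> (\<exists>j\<in>I. \<forall>i\<in>S. (i, j) \<in> r))"

definition coherence :: "'m rel \<Rightarrow> ('a, 'f, 'r, 'm) aclass \<Rightarrow> bool" where
  "coherence \<mu> K \<longleftrightarrow>
     (\<forall>M0\<in>Mod K. \<forall>M1\<in>Mod K. \<forall>M2\<in>Mod K.
        (M0, M2) \<in> Le K \<and> (M1, M2) \<in> Le K \<and> substruc \<mu> (Lang K) M0 M1 \<longrightarrow> (M0, M1) \<in> Le K)"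

text \<open>
  The index posets are taken on the type of structures. This covers index posets of every type: the
  set of members of a \<open>\<mu>\<close>-directed system is itself \<open>\<mu>\<close>-directed under \<open>Le K\<close> and has the same union.
\<close>

definition tarski_vaught :: "'m rel \<Rightarrow> ('a, 'f, 'r, 'm) aclass \<Rightarrow> bool" where
  "tarski_vaught \<mu> K \<longleftrightarrow>
     (\<forall>(I :: ('a, 'f, 'r, 'm) struc set) r M.
        mu_directed \<mu> I r \<and> (\<forall>i\<in>I. M i \<in> Mod K) \<and> (\<forall>(i, j)\<in>r. (M i, M j) \<in> Le K) \<longrightarrow>
          union_struc \<mu> (Lang K) I M \<in> Mod K \<and>
          (\<forall>j\<in>I. (M j, union_struc \<mu> (Lang K) I M) \<in> Le K) \<and>
          (\<forall>N\<in>Mod K. (\<forall>i\<in>I. (M i, N) \<in> Le K) \<longrightarrow> (union_struc \<mu> (Lang K) I M, N) \<in> Le K))"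

definition is_LST_cardinal :: "'m rel \<Rightarrow> ('a, 'f, 'r, 'm) aclass \<Rightarrow> 'k rel \<Rightarrow> bool" where
  "is_LST_cardinal \<mu> K \<kappa> \<longleftrightarrow>
     Card_order \<kappa> \<and> \<kappa> =o cpow_less \<kappa> \<mu> \<and> |fsyms (Lang K) <+> rsyms (Lang K)| +c \<mu> \<le>o \<kappa> \<and>
     (\<forall>M\<in>Mod K. \<forall>A\<subseteq>univ M.
        \<exists>N. (N, M) \<in> Le K \<and> A \<subseteq> univ N \<and> |univ N| \<le>o cpow_less |A| \<mu> +c \<kappa>)"

text \<open>
  A quantifier over cardinals has to range over the cardinals represented on some type. The type
  chosen here represents all cardinals up to two to the power of the size of the universe type plus
  the number of symbols plus \<open>\<mu>\<close>, so it contains an LST cardinal as soon as there is one on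
  any type; and since cardinals below a given one are represented on the same type, \<open>LS \<mu> K\<close> is the
  least LST cardinal among all cardinals.
\<close>

type_synonym ('a, 'f, 'r, 'm) ls_type = "('a + 'f + 'r + 'm) set"

definition LST :: "'m rel \<Rightarrow> ('a, 'f, 'r, 'm) aclass \<Rightarrow> bool" where
  "LST \<mu> K \<longleftrightarrow> (\<exists>\<kappa> :: ('a, 'f, 'r, 'm) ls_type rel. is_LST_cardinal \<mu> K \<kappa>)"

definition LS :: "'m rel \<Rightarrow> ('a, 'f, 'r, 'm) aclass \<Rightarrow> ('a, 'f, 'r, 'm) ls_type rel" where
  "LS \<mu> K = (SOME \<kappa>. is_LST_cardinal \<mu> K \<kappa> \<and>
     (\<forall>\<kappa>' :: ('a, 'f, 'r, 'm) ls_type rel. is_LST_cardinal \<mu> K \<kappa>' \<longrightarrow> \<kappa> \<le>o \<kappa>'))"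

definition mu_AEC :: "'m rel \<Rightarrow> ('a, 'f, 'r, 'm) aclass \<Rightarrow> bool" where
  "mu_AEC \<mu> K \<longleftrightarrow> Cinfinite \<mu> \<and> regularCard \<mu> \<and> mu_abstract_class \<mu> K \<and>
     coherence \<mu> K \<and> tarski_vaught \<mu> K \<and> LST \<mu> K"


section \<open>Models of a given cardinality\<close>

definition Mod_card :: "('a, 'f, 'r, 'm) aclass \<Rightarrow> 'k rel \<Rightarrow> ('a, 'f, 'r, 'm) struc set" where
  "Mod_card K \<chi> = {M \<in> Mod K. |univ M| =o \<chi>}"

definition iso_rel :: "'m rel \<Rightarrow> ('a, 'f, 'r, 'm) aclass \<Rightarrow> ('a, 'f, 'r, 'm) struc rel" where
  "iso_rel \<mu> K = {(M, N). \<exists>h. iso \<mu> (Lang K) h M N}"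

definition num_models ::
  "'m rel \<Rightarrow> 'k rel \<Rightarrow> ('a, 'f, 'r, 'm) aclass \<Rightarrow> ('a, 'f, 'r, 'm) struc set rel" where
  "num_models \<mu> \<chi> K =
     |Mod_card K \<chi> // (iso_rel \<mu> K \<inter> Mod_card K \<chi> \<times> Mod_card K \<chi>)|"

text \<open>The ordinal \<open>\<delta>\<close> is given as a well-order, and chains of length \<open>\<delta>\<close> are indexed by its field.\<close>

definition chain_extension ::
  "('a, 'f, 'r, 'm) aclass \<Rightarrow> 'k rel \<Rightarrow> 'd rel \<Rightarrow> bool" where
  "chain_extension K lam \<delta> \<longleftrightarrow>
     (\<forall>M. (\<forall>i\<in>Field \<delta>. M i \<in> Mod_card K lam) \<and> (\<forall>(i, j)\<in>\<delta>. (M i, M j) \<in> Le K) \<longrightarrow>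
        (\<exists>M'\<in>Mod_card K lam. \<forall>i\<in>Field \<delta>. (M i, M') \<in> Le K))"

definition K_embedding ::
  "'m rel \<Rightarrow> ('a, 'f, 'r, 'm) aclass \<Rightarrow> ('a \<Rightarrow> 'a) \<Rightarrow>
   ('a, 'f, 'r, 'm) struc \<Rightarrow> ('a, 'f, 'r, 'm) struc \<Rightarrow> bool" where
  "K_embedding \<mu> K g M N \<longleftrightarrow> (\<exists>M'. iso \<mu> (Lang K) g M M' \<and> (M', N) \<in> Le K)"

definition amalgamation :: "'m rel \<Rightarrow> ('a, 'f, 'r, 'm) aclass \<Rightarrow> 'k rel \<Rightarrow> bool" where
  "amalgamation \<mu> K lam \<longleftrightarrow>
     (\<forall>M0\<in>Mod_card K lam. \<forall>M1\<in>Mod_card K lam. \<forall>M2\<in>Mod_card K lam.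
        (M0, M1) \<in> Le K \<and> (M0, M2) \<in> Le K \<longrightarrow>
        (\<exists>N\<in>Mod_card K lam. \<exists>g1 g2.
           K_embedding \<mu> K g1 M1 N \<and> K_embedding \<mu> K g2 M2 N \<and>
           (\<forall>x\<in>univ M0. g1 x = g2 x)))"

end

theory Submission
  imports Defs
begin

text \<open>
  Put \<open>\<kappa> = lam\<^sup>+\<close>. Since \<open>2\<^bsup>lam\<^esup> = \<kappa>\<close> and \<open>lam\<^bsup>\<mu>\<^esup> = lam\<close>, Gregory's theorem gives a diamond
  on the points of \<open>\<kappa>\<close> of cofinality \<open>\<mu>\<close>; unions of chains are available exactly at points of
  cofinality at least \<open>\<mu>\<close>, and the chain extension property bridges the others. If amalgamation
  fails, then by categoricity it fails over every model of cardinality \<open>lam\<close>, also along any isomorphism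
  of two such models. One builds a tree of models indexed by the subsets of the ordinals below \<open>\<kappa>\<close>.
  Whenever the diamond guesses two branches and an isomorphism between the models built so far
  along them, these are extended by models that are not amalgamable along that isomorphism. An
  isomorphism between the unions along two distinct branches would be guessed at some stage and
  then amalgamate the two extensions. Hence there are \<open>2\<^bsup>\<kappa>\<^esup>\<close> models of cardinality \<open>\<kappa>\<close>.
\<close>

section \<open>Structures and isomorphisms\<close>

lemma map_tuple_in_tuples:
  assumes "x \<in> tuples \<mu> a A" "h ` A \<subseteq> B"
  shows "map_tuple \<mu> a h x \<in> tuples \<mu> a B"
  using assms by (fastforce simp: map_tuple_def tuples_def PiE_iff extensional_def)

lemma map_tuple_map_tuple:
  "map_tuple \<mu> a g (map_tuple \<mu> a h x) = map_tuple \<mu> a (\<lambda>u. g (h u)) x"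
  by (auto simp: map_tuple_def fun_eq_iff)

lemma map_tuple_cong:
  assumes "x \<in> tuples \<mu> a A" "\<And>u. u \<in> A \<Longrightarrow> h u = g u"
  shows "map_tuple \<mu> a h x = map_tuple \<mu> a g x"
  using assms by (fastforce simp: map_tuple_def tuples_def fun_eq_iff)

lemma map_tuple_ident:
  assumes "x \<in> tuples \<mu> a A" "\<And>u. u \<in> A \<Longrightarrow> h u = u"
  shows "map_tuple \<mu> a h x = x"
  using assms by (fastforce simp: map_tuple_def tuples_def fun_eq_iff PiE_iff extensional_def)

lemma tuples_mono: "A \<subseteq> B \<Longrightarrow> tuples \<mu> a A \<subseteq> tuples \<mu> a B"
  by (auto simp: tuples_def PiE_iff)

lemma struc_eqI:
  assumes "is_struc \<mu> L M" "is_struc \<mu> L N" "univ M = univ N"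
    and "\<And>F x. F \<in> fsyms L \<Longrightarrow> x \<in> tuples \<mu> (farity L F) (univ M) \<Longrightarrow> fn M F x = fn N F x"
    and "\<And>R. R \<in> rsyms L \<Longrightarrow> rl M R = rl N R"
  shows "(M :: ('a, 'f, 'r, 'm) struc) = N"
proof -
  have "fn M = fn N"
  proof (rule PiE_ext)
    show "fn M \<in> (\<Pi>\<^sub>E F\<in>fsyms L. tuples \<mu> (farity L F) (univ M) \<rightarrow>\<^sub>E univ M)"
      using assms(1) by (simp add: is_struc_def)
    show "fn N \<in> (\<Pi>\<^sub>E F\<in>fsyms L. tuples \<mu> (farity L F) (univ M) \<rightarrow>\<^sub>E univ M)"
      using assms(2,3) by (simp add: is_struc_def)
    show "fn M F = fn N F" if "F \<in> fsyms L" for F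
      using that assms(1-4)
      by (intro PiE_ext[of _ "tuples \<mu> (farity L F) (univ M)" "\<lambda>_. univ M"])
        (auto simp: is_struc_def dest: PiE_mem)
  qed
  moreover have "rl M = rl N"
    using assms(1-3,5)
    by (intro PiE_ext[of _ "rsyms L" "\<lambda>R. Pow (tuples \<mu> (rarity L R) (univ M))"])
       (auto simp: is_struc_def)
  ultimately show ?thesis using assms(3) by simp
qed

lemma is_struc_fn:
  assumes "is_struc \<mu> L M" "F \<in> fsyms L" "x \<in> tuples \<mu> (farity L F) (univ M)"
  shows "fn M F x \<in> univ M"
  using assms by (auto simp: is_struc_def PiE_iff)

lemma is_struc_rl:
  assumes "is_struc \<mu> L M" "R \<in> rsyms L"
  shows "rl M R \<subseteq> tuples \<mu> (rarity L R) (univ M)"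
  using assms by (auto simp: is_struc_def PiE_iff)

lemma iso_strucD:
  assumes "iso \<mu> L h M N"
  shows "is_struc \<mu> L M" "is_struc \<mu> L N" "bij_betw h (univ M) (univ N)"
    "inj_on h (univ M)" "h ` univ M = univ N"
  using assms by (auto simp: iso_def bij_betw_def)

lemma iso_cong:
  assumes "iso \<mu> L h M N" "\<And>u. u \<in> univ M \<Longrightarrow> h u = g u"
  shows "iso \<mu> L g M N"
proof -
  have "map_tuple \<mu> a h x = map_tuple \<mu> a g x" if "x \<in> tuples \<mu> a (univ M)" for a x
    using map_tuple_cong[OF that] assms(2) by auto
  moreover have "bij_betw g (univ M) (univ N)"
    using assms by (metis bij_betw_cong iso_def)
  ultimately show ?thesis using assms(1) assms(2) is_struc_fn[OF iso_strucD(1)[OF assms(1)]]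
    unfolding iso_def by metis
qed

lemma iso_id: "is_struc \<mu> L M \<Longrightarrow> iso \<mu> L (\<lambda>u. u) M M"
  by (auto simp: iso_def map_tuple_ident bij_betw_def)

lemma iso_compose:
  assumes "iso \<mu> L h M N" "iso \<mu> L g N P"
  shows "iso \<mu> L (\<lambda>u. g (h u)) M P"
proof -
  have t: "map_tuple \<mu> a h x \<in> tuples \<mu> a (univ N)" if "x \<in> tuples \<mu> a (univ M)" for a x
    using map_tuple_in_tuples[OF that, of h "univ N"] iso_strucD(5)[OF assms(1)] by blast
  have "bij_betw (\<lambda>u. g (h u)) (univ M) (univ P)"
    using bij_betw_trans[OF iso_strucD(3)[OF assms(1)] iso_strucD(3)[OF assms(2)]]
    by (simp add: comp_def)
  then show ?thesis using assms t unfolding iso_def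
    by (simp add: map_tuple_map_tuple[symmetric])
qed

text \<open>Since \<open>h\<close> is onto, every tuple of the target is the image of a tuple of
  \<open>M\<close>, so \<open>h\<close> dictates all operations and relations there. This makes the
  image \<open>f[M]\<close> a well-defined structure.\<close>

lemma iso_unique:
  assumes "iso \<mu> L h M N" "iso \<mu> L h M N'"
  shows "(N :: ('a, 'f, 'r, 'm) struc) = N'"
proof (rule struc_eqI)
  let ?g = "inv_into (univ M) h"
  show s: "is_struc \<mu> L N" "is_struc \<mu> L N'" using assms by (auto simp: iso_def)
  show u: "univ N = univ N'" using assms by (auto simp: iso_def bij_betw_def)
  have hg: "h (?g y) = y" if "y \<in> univ N" for y
    using that iso_strucD(5)[OF assms(1)] by (metis f_inv_into_f)
  have gN: "?g ` univ N \<subseteq> univ M"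
    using iso_strucD(5)[OF assms(1)] by (auto intro: inv_into_into)
  have t: "map_tuple \<mu> a ?g x \<in> tuples \<mu> a (univ M) \<and> map_tuple \<mu> a h (map_tuple \<mu> a ?g x) = x"
    if "x \<in> tuples \<mu> a (univ N)" for a x
    using map_tuple_in_tuples[OF that gN] map_tuple_ident[OF that, of "\<lambda>u. h (?g u)"] hg
    by (simp add: map_tuple_map_tuple)
  show "fn N F x = fn N' F x" if "F \<in> fsyms L" "x \<in> tuples \<mu> (farity L F) (univ N)" for F x
    using t[OF that(2)] that(1) assms unfolding iso_def by metis
  show "rl N R = rl N' R" if "R \<in> rsyms L" for R
  proof -
    have "x \<in> rl N R \<longleftrightarrow> x \<in> rl N' R" if "x \<in> tuples \<mu> (rarity L R) (univ N)" for x
      using t[OF that] \<open>R \<in> rsyms L\<close> assms unfolding iso_def by metis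
    then show ?thesis using is_struc_rl[OF s(1) that] is_struc_rl[OF s(2) that] u by auto
  qed
qed

lemma iso_inverse:
  assumes "iso \<mu> L h M N"
  shows "iso \<mu> L (inv_into (univ M) h) N M"
proof -
  let ?g = "inv_into (univ M) h"
  note D = iso_strucD[OF assms]
  have hg: "h (?g y) = y" if "y \<in> univ N" for y
    using that D(5) by (metis f_inv_into_f)
  have gh: "?g (h y) = y" if "y \<in> univ M" for y
    using that D(4) by simp
  have gN: "?g ` univ N \<subseteq> univ M" using D(5) by (auto intro: inv_into_into)
  have t: "map_tuple \<mu> a ?g x \<in> tuples \<mu> a (univ M)" "map_tuple \<mu> a h (map_tuple \<mu> a ?g x) = x"
    if "x \<in> tuples \<mu> a (univ N)" for a x
    using map_tuple_in_tuples[OF that gN] map_tuple_ident[OF that, of "\<lambda>u. h (?g u)"] hg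
    by (simp_all add: map_tuple_map_tuple)
  have "?g (fn N F x) = fn M F (map_tuple \<mu> (farity L F) ?g x)"
    if "F \<in> fsyms L" "x \<in> tuples \<mu> (farity L F) (univ N)" for F x
  proof -
    have "h (fn M F (map_tuple \<mu> (farity L F) ?g x)) = fn N F x"
      using t[OF that(2)] assms that(1) unfolding iso_def by metis
    then show ?thesis using gh is_struc_fn[OF D(1) that(1) t(1)[OF that(2)]] by metis
  qed
  moreover have "x \<in> rl N R \<longleftrightarrow> map_tuple \<mu> (rarity L R) ?g x \<in> rl M R"
    if "R \<in> rsyms L" "x \<in> tuples \<mu> (rarity L R) (univ N)" for R x
    using t[OF that(2)] assms that(1) unfolding iso_def by metis
  ultimately show ?thesis using D bij_betw_inv_into[OF D(3)] unfolding iso_def by blast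
qed

lemma substruc_eqI:
  assumes "substruc \<mu> L M N" "univ M = univ N"
  shows "(M :: ('a, 'f, 'r, 'm) struc) = N"
proof (rule struc_eqI[of \<mu> L])
  show "rl M R = rl N R" if "R \<in> rsyms L" for R
    using is_struc_rl[of \<mu> L N R] that assms by (auto simp: substruc_def)
qed (use assms in \<open>auto simp: substruc_def\<close>)

lemma iso_restrict:
  assumes "iso \<mu> L h M N" "substruc \<mu> L M' M" "substruc \<mu> L N' N" "h ` univ M' = univ N'"
  shows "iso \<mu> L h M' N'"
proof -
  have sub: "univ M' \<subseteq> univ M" using assms(2) by (simp add: substruc_def)
  have t: "x \<in> tuples \<mu> a (univ M)" "map_tuple \<mu> a h x \<in> tuples \<mu> a (univ N')"
    if "x \<in> tuples \<mu> a (univ M')" for a x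
    using that tuples_mono[OF sub, of \<mu> a] map_tuple_in_tuples[OF that, of h "univ N'"] assms(4) by blast+
  have "bij_betw h (univ M') (univ N')"
    using assms(4) iso_strucD(4)[OF assms(1)] sub by (auto simp: bij_betw_def inj_on_subset)
  moreover have "h (fn M' F x) = fn N' F (map_tuple \<mu> (farity L F) h x)"
    if "F \<in> fsyms L" "x \<in> tuples \<mu> (farity L F) (univ M')" for F x
    using that t[OF that(2)] assms(1-3) by (simp add: substruc_def iso_def)
  moreover have "x \<in> rl M' R \<longleftrightarrow> map_tuple \<mu> (rarity L R) h x \<in> rl N' R"
    if "R \<in> rsyms L" "x \<in> tuples \<mu> (rarity L R) (univ M')" for R x
    using that t[OF that(2)] assms(1-3) by (simp add: substruc_def iso_def)
  ultimately show ?thesis using assms(2,3) by (simp add: iso_def substruc_def)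
qed

lemma substruc_subset:
  assumes "substruc \<mu> L A N" "substruc \<mu> L B N" "univ A \<subseteq> univ B"
  shows "substruc \<mu> L A B"
proof -
  have t: "x \<in> tuples \<mu> a (univ B)" if "x \<in> tuples \<mu> a (univ A)" for a x
    using that tuples_mono[OF assms(3), of \<mu> a] by blast
  then show ?thesis using assms by (fastforce simp: substruc_def)
qed

text \<open>Operations and relations are carried to the image through the inverse of
  \<open>h\<close>. Models are moved into a prescribed set in this way.\<close>

lemma ex_iso_image:
  assumes "is_struc \<mu> L (M :: ('a, 'f, 'r, 'm) struc)" "inj_on h (univ M)"
  shows "\<exists>N. iso \<mu> L h M N"
proof -
  let ?g = "inv_into (univ M) h"
  let ?U = "h ` univ M"
  define N :: "('a, 'f, 'r, 'm) struc" where "N =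
    \<lparr>univ = ?U,
     fn = (\<lambda>F\<in>fsyms L. \<lambda>x\<in>tuples \<mu> (farity L F) ?U. h (fn M F (map_tuple \<mu> (farity L F) ?g x))),
     rl = (\<lambda>R\<in>rsyms L. {x \<in> tuples \<mu> (rarity L R) ?U. map_tuple \<mu> (rarity L R) ?g x \<in> rl M R})\<rparr>"
  have gh: "?g (h y) = y" if "y \<in> univ M" for y using that assms(2) by simp
  have gU: "?g ` ?U \<subseteq> univ M" using gh by auto
  have t: "map_tuple \<mu> a ?g (map_tuple \<mu> a h x) = x" if "x \<in> tuples \<mu> a (univ M)" for a x
    using map_tuple_ident[OF that, of "\<lambda>u. ?g (h u)"] gh by (simp add: map_tuple_map_tuple)
  have t': "map_tuple \<mu> a h x \<in> tuples \<mu> a ?U" if "x \<in> tuples \<mu> a (univ M)" for a x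
    using map_tuple_in_tuples[OF that] by blast
  have "h (fn M F (map_tuple \<mu> (farity L F) ?g x)) \<in> ?U"
    if "F \<in> fsyms L" "x \<in> tuples \<mu> (farity L F) ?U" for F x
    using is_struc_fn[OF assms(1) that(1) map_tuple_in_tuples[OF that(2) gU]] by blast
  then have "is_struc \<mu> L N"
    by (auto simp: is_struc_def N_def PiE_iff)
  then have "iso \<mu> L h M N"
    using assms t t' by (auto simp: iso_def bij_betw_def) (auto simp: N_def)
  then show ?thesis by blast
qed

section \<open>\<open>\<mu>\<close>-abstract classes\<close>

lemma Le_ModD:
  assumes "mu_abstract_class \<mu> K" "(M, N) \<in> Le K"
  shows "M \<in> Mod K" "N \<in> Mod K" "substruc \<mu> (Lang K) M N" "univ M \<subseteq> univ N"
  using assms by (auto simp: mu_abstract_class_def preorder_on_def refl_on_def substruc_def)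

lemma Le_trans:
  assumes "mu_abstract_class \<mu> K" "(M, N) \<in> Le K" "(N, P) \<in> Le K"
  shows "(M, P) \<in> Le K"
  using assms unfolding mu_abstract_class_def preorder_on_def by (metis transD)

lemma Le_refl:
  assumes "mu_abstract_class \<mu> K" "M \<in> Mod K"
  shows "(M, M) \<in> Le K"
  using assms unfolding mu_abstract_class_def preorder_on_def refl_on_def by blast

lemma Mod_is_struc: "mu_abstract_class \<mu> K \<Longrightarrow> M \<in> Mod K \<Longrightarrow> is_struc \<mu> (Lang K) M"
  by (auto simp: mu_abstract_class_def)

lemma iso_Mod:
  assumes "mu_abstract_class \<mu> K" "N \<in> Mod K" "iso \<mu> (Lang K) f N N'"
  shows "N' \<in> Mod K"
  using assms unfolding mu_abstract_class_def by blast

lemma iso_Le: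
  assumes "mu_abstract_class \<mu> K" "(M, N) \<in> Le K" "iso \<mu> (Lang K) f N N'"
  obtains M' where "iso \<mu> (Lang K) f M M'" "(M', N') \<in> Le K"
  using assms Le_ModD(2)[OF assms(1,2)] unfolding mu_abstract_class_def by metis

text \<open>The axiom only supplies some image of \<open>M\<close> below \<open>N'\<close>;
  uniqueness of images identifies it with the given \<open>M'\<close>.\<close>

lemma iso_Le_iso:
  assumes "mu_abstract_class \<mu> K" "(M, N) \<in> Le K" "iso \<mu> (Lang K) f N N'" "iso \<mu> (Lang K) f M M'"
  shows "(M', N') \<in> Le K"
  using iso_Le[OF assms(1-3)] iso_unique[OF assms(4)] by metis

lemma Le_antisym:
  assumes "mu_abstract_class \<mu> K" "(M, N) \<in> Le K" "(N, M) \<in> Le K"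
  shows "(M :: ('a, 'f, 'r, 'm) struc) = N"
  using Le_ModD[OF assms(1,2)] Le_ModD[OF assms(1,3)] by (auto intro: substruc_eqI)

lemma Mod_card_iso:
  assumes "mu_abstract_class \<mu> K" "M \<in> Mod_card K \<chi>" "iso \<mu> (Lang K) f M N"
  shows "N \<in> Mod_card K \<chi>"
proof -
  have "|univ N| =o |univ M|"
    using card_of_ordIsoI[OF iso_strucD(3)[OF assms(3)]] ordIso_symmetric by blast
  then show ?thesis
    using assms iso_Mod[OF assms(1) _ assms(3)] by (auto simp: Mod_card_def intro: ordIso_transitive)
qed

lemma K_embedding_iso:
  assumes "iso \<mu> (Lang K) f M M'" "K_embedding \<mu> K g M' N"
  shows "K_embedding \<mu> K (\<lambda>x. g (f x)) M N"
  using assms iso_compose unfolding K_embedding_def by metis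

lemma K_embedding_id:
  assumes "mu_abstract_class \<mu> K" "(M, N) \<in> Le K"
  shows "K_embedding \<mu> K (\<lambda>x. x) M N"
  using assms(2) iso_id[OF Mod_is_struc[OF assms(1) Le_ModD(1)[OF assms]]]
  unfolding K_embedding_def by blast

text \<open>
  The Tarski--Vaught axiom for a family over an arbitrary directed index: the union is
  reindexed by its own members.
\<close>

lemma directed_union:
  fixes M :: "'i \<Rightarrow> ('a, 'f, 'r, 'm) struc"
  assumes ac: "mu_abstract_class \<mu> K" and tv: "tarski_vaught \<mu> K"
    and Mod: "\<And>i. i \<in> I \<Longrightarrow> M i \<in> Mod K"
    and dir: "\<And>S. S \<subseteq> I \<Longrightarrow> |S| <o \<mu> \<Longrightarrow> \<exists>j\<in>I. \<forall>i\<in>S. (M i, M j) \<in> Le K"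
  defines "N \<equiv> union_struc \<mu> (Lang K) (M ` I) (\<lambda>x. x)"
  shows "N \<in> Mod K" "univ N = (\<Union>i\<in>I. univ (M i))" "\<And>i. i \<in> I \<Longrightarrow> (M i, N) \<in> Le K"
    "\<And>P. P \<in> Mod K \<Longrightarrow> (\<And>i. i \<in> I \<Longrightarrow> (M i, P) \<in> Le K) \<Longrightarrow> (N, P) \<in> Le K"
proof -
  let ?r = "Le K \<inter> (M ` I \<times> M ` I)"
  have "partial_order_on (M ` I) ?r"
    unfolding partial_order_on_def preorder_on_def
    using Mod Le_refl[OF ac] Le_trans[OF ac] Le_antisym[OF ac]
    by (auto simp: refl_on_def trans_def antisym_def)
  moreover have "\<exists>j\<in>M ` I. \<forall>i\<in>S. (i, j) \<in> ?r" if S: "S \<subseteq> M ` I" "|S| <o \<mu>" for S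
  proof -
    \<comment> \<open>One index is kept for each member of \<open>S\<close>, so that the index set
      is as small as \<open>S\<close> and \<open>dir\<close> applies to it.\<close>
    obtain S' where S': "S' \<subseteq> I" "S = M ` S'" "inj_on M S'"
      using S(1) by (meson subset_image_inj)
    then have "|S'| =o |S|" using card_of_ordIsoI[of M S' S] by (auto simp: bij_betw_def)
    then have "|S'| <o \<mu>" using S(2) ordIso_ordLess_trans by blast
    then show ?thesis using dir[OF S'(1)] S' by blast
  qed
  ultimately have "mu_directed \<mu> (M ` I) ?r" by (auto simp: mu_directed_def)
  then have "N \<in> Mod K \<and> (\<forall>j\<in>M ` I. (j, N) \<in> Le K) \<and>
      (\<forall>P\<in>Mod K. (\<forall>i\<in>M ` I. (i, P) \<in> Le K) \<longrightarrow> (N, P) \<in> Le K)"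
    using tv[unfolded tarski_vaught_def, rule_format, of "M ` I" ?r "\<lambda>x. x"] Mod
    unfolding N_def by auto
  then show "N \<in> Mod K" "\<And>i. i \<in> I \<Longrightarrow> (M i, N) \<in> Le K"
    "\<And>P. P \<in> Mod K \<Longrightarrow> (\<And>i. i \<in> I \<Longrightarrow> (M i, P) \<in> Le K) \<Longrightarrow> (N, P) \<in> Le K"
    by auto
  show "univ N = (\<Union>i\<in>I. univ (M i))" by (simp add: N_def union_struc_def)
qed

section \<open>Well-orders of regular type\<close>

lemma underS_trans:
  assumes "Well_order r" "a \<in> underS r b" "b \<in> under r c"
  shows "a \<in> underS r c"
proof -
  have "trans r" "antisym r"
    using assms(1) by (auto simp: order_on_defs)
  then show ?thesis
    using assms(2,3) unfolding underS_def under_def trans_def antisym_def by blast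
qed

lemma underS_trans':
  assumes "Well_order r" "a \<in> under r b" "b \<in> underS r c"
  shows "a \<in> underS r c"
proof -
  have "trans r" "antisym r"
    using assms(1) by (auto simp: order_on_defs)
  then show ?thesis
    using assms(2,3) unfolding underS_def under_def trans_def antisym_def by blast
qed

lemma underS_less_trans:
  "Well_order r \<Longrightarrow> a \<in> underS r b \<Longrightarrow> b \<in> underS r c \<Longrightarrow> a \<in> underS r c"
  by (rule underS_trans[OF _ _ subsetD[OF underS_subset_under]])

lemma under_refl: "Well_order r \<Longrightarrow> a \<in> Field r \<Longrightarrow> a \<in> under r a"
  by (auto simp: order_on_defs refl_on_def under_def)

lemma underS_linear:
  assumes "Well_order r" "a \<in> Field r" "b \<in> Field r"
  shows "a \<in> underS r b \<or> b \<in> under r a"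
proof -
  have "Total r" using assms(1) by (auto simp: order_on_defs)
  then show ?thesis using assms(2,3) under_refl[OF assms(1,2)]
    unfolding underS_def under_def total_on_def by (cases "a = b") auto
qed

lemma wf_strict: "Well_order r \<Longrightarrow> wf (r - Id)"
  by (auto simp: well_order_on_def)

lemma underS_iff: "a \<in> underS r b \<longleftrightarrow> (a, b) \<in> r - Id"
  by (auto simp: underS_def)

lemma regular_bounded:
  assumes r: "Cinfinite r" "regularCard r" and X: "X \<subseteq> Field r" "|X| <o r"
  shows "\<exists>b\<in>Field r. X \<subseteq> underS r b"
proof -
  have wo: "Well_order r" using r by (auto simp: card_order_on_def)
  have "\<not> cofinal X r"
    using r(2) X not_ordLess_ordIso unfolding regularCard_def by blast
  then obtain a where a: "a \<in> Field r" "\<forall>b\<in>X. a \<notin> underS r b"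
    unfolding cofinal_def underS_def by auto
  \<comment> \<open>The point \<open>a\<close> bounds \<open>X\<close> only weakly; a larger point
    makes the bound strict.\<close>
  obtain c where c: "c \<in> Field r" "a \<in> underS r c"
    using infinite_Card_order_limit[of r a] r(1) a(1) unfolding cinfinite_def underS_def by blast
  have "X \<subseteq> underS r c"
    using a X(1) c(2) underS_linear[OF wo] underS_trans'[OF wo] by blast
  then show ?thesis using c(1) by blast
qed

text \<open>This says that the predecessors of \<open>\<delta>\<close> are
  \<open>\<mu>\<close>-directed, which is what the union axiom asks for. At limits it means
  cofinality at least \<open>\<mu>\<close>; successors satisfy it through their last predecessor,
  and for infinite \<open>\<mu>\<close> the least point fails it because of the empty
  \<open>X\<close>.\<close>

definition cof_ge :: "'i rel \<Rightarrow> 'm rel \<Rightarrow> 'i \<Rightarrow> bool" where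
  "cof_ge \<kappa> \<mu> \<delta> \<longleftrightarrow>
     (\<forall>X\<subseteq>underS \<kappa> \<delta>. |X| <o \<mu> \<longrightarrow> (\<exists>b\<in>underS \<kappa> \<delta>. X \<subseteq> under \<kappa> b))"

lemma cof_geD:
  assumes "cof_ge \<kappa> \<mu> \<delta>" "X \<subseteq> underS \<kappa> \<delta>" "|X| <o \<mu>"
  obtains b where "b \<in> underS \<kappa> \<delta>" "X \<subseteq> under \<kappa> b"
  using assms(1)[unfolded cof_ge_def, rule_format, OF assms(2,3)] that by blast

lemma cof_ge_nonempty:
  fixes \<kappa> :: "'i rel"
  assumes "Cinfinite \<mu>" "cof_ge \<kappa> \<mu> \<delta>"
  obtains b where "b \<in> underS \<kappa> \<delta>"
proof -
  have "|{} :: 'i set| <o \<mu>"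
    using assms(1) by (intro finite_ordLess_infinite[OF card_of_Well_order])
      (auto simp: Field_card_of cinfinite_def card_order_on_def)
  then show ?thesis using cof_geD[OF assms(2) empty_subsetI] that by metis
qed

section \<open>Cardinal bounds for coverings, insertions and function spaces\<close>

lemma ex_covering:
  assumes "Card_order r" "|S| \<le>o r"
  shows "\<exists>X. S \<subseteq> X ` Field r"
proof -
  have "|S| \<le>o |Field r|"
    using assms card_of_Field_ordIso ordIso_symmetric ordLeq_ordIso_trans by blast
  then obtain f where f: "inj_on f S" "f ` S \<subseteq> Field r"
    using card_of_ordLeq[of S "Field r"] by blast
  then have "S \<subseteq> inv_into S f ` Field r"
    by (force simp: image_iff intro: inv_into_f_f[symmetric])
  then show ?thesis by blast
qed

lemma card_insert_le:
  assumes "Cinfinite r" "|A| \<le>o r"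
  shows "|insert a A| \<le>o r"
proof -
  have "\<not> finite (Field r)" using assms(1) by (simp add: cinfinite_def)
  then have "|{a} \<union> A| \<le>o r"
    using assms Card_order_singl_ordLeq[of r a] infinite_imp_nonempty
    by (intro card_of_Un_ordLeq_infinite_Field) auto
  then show ?thesis by simp
qed

lemma PiE_eq_Func: "(A \<rightarrow>\<^sub>E B) = Func A B"
  by (auto simp: Func_def PiE_iff extensional_def)

lemma card_PiE_le:
  assumes "|A| \<le>o a" "|V| \<le>o v" "Cinfinite v" "Cinfinite a"
  shows "|A \<rightarrow>\<^sub>E V| \<le>o v ^c a"
proof (cases "A = {}")
  \<comment> \<open>The empty exponent is treated apart because exponentiation is not monotone from
    exponent 0 when the base is 0, and \<open>V\<close> may be empty.\<close>
  case True
  have "|A \<rightarrow>\<^sub>E V| \<le>o v"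
    using True Card_order_singl_ordLeq[of v "\<lambda>_. undefined"] assms(3) infinite_imp_nonempty
    by (auto simp: cinfinite_def)
  also have "v \<le>o v ^c a"
    using assms Cinfinite_Cnotzero by (intro ordLeq_cexp1) auto
  finally show ?thesis .
next
  case False
  have "|A \<rightarrow>\<^sub>E V| = |V| ^c |A|" by (simp add: PiE_eq_Func cexp_def Field_card_of)
  also have "|V| ^c |A| \<le>o v ^c a"
    using assms False by (intro cexp_mono') (auto simp: Field_card_of)
  finally show ?thesis .
qed

text \<open>
  Iterating \<open>H\<close> along \<open>\<mu>\<close> produces points of cofinality \<open>\<mu>\<close> that are closed under \<open>H\<close>.
\<close>

lemma ex_closed_point:
  assumes \<mu>: "Cinfinite \<mu>" "regularCard \<mu>" and \<kappa>: "Cinfinite \<kappa>" "regularCard \<kappa>"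
    and less: "\<mu> <o \<kappa>" and H: "\<And>a. a \<in> Field \<kappa> \<Longrightarrow> H a \<in> Field \<kappa>"
  shows "\<exists>\<delta>\<in>Field \<kappa>. \<exists>f. (\<forall>j\<in>Field \<mu>. f j \<in> underS \<kappa> \<delta> \<and> H (f j) \<in> underS \<kappa> \<delta>) \<and>
    (\<forall>a\<in>underS \<kappa> \<delta>. \<exists>j\<in>Field \<mu>. a \<in> underS \<kappa> (f j)) \<and> cof_ge \<kappa> \<mu> \<delta>"
proof -
  have wo\<mu>: "Well_order \<mu>" and wo\<kappa>: "Well_order \<kappa>" using \<mu> \<kappa> by (auto simp: card_order_on_def)
  have small: "\<exists>b\<in>Field \<kappa>. g ` J \<subseteq> underS \<kappa> b"
    if "J \<subseteq> Field \<mu>" "g ` J \<subseteq> Field \<kappa>" for g J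
  proof (rule regular_bounded[OF \<kappa> that(2)])
    have "|g ` J| \<le>o |Field \<mu>|"
      using card_of_image card_of_mono1[OF that(1)] ordLeq_transitive by blast
    moreover have "|Field \<mu>| =o \<mu>" using \<mu> card_of_Field_ordIso by blast
    ultimately show "|g ` J| <o \<kappa>"
      using less ordLeq_ordLess_trans ordIso_ordLess_trans by blast
  qed
  \<comment> \<open>The sequence is to climb strictly past all its earlier values and past their
    images under \<open>H\<close>.\<close>
  define P where "P f j b \<longleftrightarrow> b \<in> Field \<kappa> \<and> (\<forall>j'\<in>underS \<mu> j. {f j', H (f j')} \<subseteq> underS \<kappa> b)"
    for f j b
  have "\<exists>f. \<forall>j. P f j (f j)"
  proof (rule dependent_wf_choice[OF wf_strict[OF wo\<mu>]])
    show "P f j b = P g j b" if "\<And>z. (z, j) \<in> \<mu> - Id \<Longrightarrow> f z = g z" for f g j b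
      using that by (auto simp: P_def underS_iff)
    show "\<exists>b. P f j b" if IH: "\<And>z. (z, j) \<in> \<mu> - Id \<Longrightarrow> P f z (f z)" for f j
    proof -
      have f: "f ` underS \<mu> j \<subseteq> Field \<kappa>" using IH by (auto simp: P_def underS_iff)
      then have Hf: "(\<lambda>z. H (f z)) ` underS \<mu> j \<subseteq> Field \<kappa>" using H by auto
      obtain b1 where b1: "b1 \<in> Field \<kappa>" "f ` underS \<mu> j \<subseteq> underS \<kappa> b1"
        using small[OF _ f] underS_Field[of _ \<mu> j] by blast
      obtain b2 where b2: "b2 \<in> Field \<kappa>" "(\<lambda>z. H (f z)) ` underS \<mu> j \<subseteq> underS \<kappa> b2"
        using small[OF _ Hf] underS_Field[of _ \<mu> j] by blast
      consider "b1 \<in> under \<kappa> b2" | "b2 \<in> under \<kappa> b1"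
        using underS_linear[OF wo\<kappa> b1(1) b2(1)] underS_subset_under by fast
      then show ?thesis
      proof cases
        case 1
        then have "P f j b2" using b1 b2 underS_trans[OF wo\<kappa>] unfolding P_def by blast
        then show ?thesis by blast
      next
        case 2
        then have "P f j b1" using b1 b2 underS_trans[OF wo\<kappa>] unfolding P_def by blast
        then show ?thesis by blast
      qed
    qed
  qed
  then obtain f where f: "\<And>j. P f j (f j)" by blast
  have fF: "f j \<in> Field \<kappa>" for j using f[of j] by (simp add: P_def)
  have step: "f j' \<in> underS \<kappa> (f j) \<and> H (f j') \<in> underS \<kappa> (f j)" if "j' \<in> underS \<mu> j" for j j'
    using f[of j] that by (auto simp: P_def)
  have suc: "\<exists>j'\<in>Field \<mu>. j \<in> underS \<mu> j'" if "j \<in> Field \<mu>" for j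
    using infinite_Card_order_limit[of \<mu> j] \<mu>(1) that unfolding cinfinite_def underS_def by blast
  \<comment> \<open>\<open>\<delta>\<close> will be the least strict upper bound of the sequence. By
    minimality no smaller \<open>a\<close> bounds the sequence, so the sequence is cofinal in
    \<open>\<delta>\<close>.\<close>
  define B where "B = {b \<in> Field \<kappa>. f ` Field \<mu> \<subseteq> underS \<kappa> b}"
  have "B \<noteq> {}" using small[of "Field \<mu>" f] fF by (auto simp: B_def)
  then obtain \<delta> where \<delta>: "\<delta> \<in> B" "\<And>b. (b, \<delta>) \<in> \<kappa> - Id \<Longrightarrow> b \<notin> B"
    using wfE_min[OF wf_strict[OF wo\<kappa>]] by (metis ex_in_conv)
  have up: "\<exists>j\<in>Field \<mu>. a \<in> underS \<kappa> (f j)" if "a \<in> underS \<kappa> \<delta>" for a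
  proof -
    have "a \<in> Field \<kappa>" using that underS_Field by fast
    moreover have "a \<notin> B" using \<delta>(2)[of a] that by (simp add: underS_iff)
    ultimately obtain j where j: "j \<in> Field \<mu>" "f j \<notin> underS \<kappa> a" by (auto simp: B_def)
    then have "a \<in> under \<kappa> (f j)" using underS_linear[OF wo\<kappa> fF \<open>a \<in> Field \<kappa>\<close>] by blast
    moreover obtain j' where "j' \<in> Field \<mu>" "j \<in> underS \<mu> j'" using suc[OF j(1)] by blast
    ultimately show ?thesis using step underS_trans'[OF wo\<kappa>] by blast
  qed
  have f\<delta>: "f j \<in> underS \<kappa> \<delta>" if "j \<in> Field \<mu>" for j
    using \<delta>(1) that by (auto simp: B_def)
  have Hf: "H (f j) \<in> underS \<kappa> \<delta>" if j: "j \<in> Field \<mu>" for j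
  proof -
    obtain j' where "j' \<in> Field \<mu>" "j \<in> underS \<mu> j'" using suc[OF j] by blast
    then show ?thesis using underS_less_trans[OF wo\<kappa>, of "H (f j)" "f j'" \<delta>] step f\<delta> by blast
  qed
  have "cof_ge \<kappa> \<mu> \<delta>"
    unfolding cof_ge_def
  proof (intro allI impI)
    fix X assume X: "X \<subseteq> underS \<kappa> \<delta>" "|X| <o \<mu>"
    have "\<forall>a\<in>X. \<exists>j. j \<in> Field \<mu> \<and> a \<in> under \<kappa> (f j)"
    proof
      fix a assume "a \<in> X"
      then obtain j where "j \<in> Field \<mu>" "a \<in> underS \<kappa> (f j)" using up[of a] X(1) by blast
      then show "\<exists>j. j \<in> Field \<mu> \<and> a \<in> under \<kappa> (f j)" by (auto simp: under_def underS_def)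
    qed
    then obtain c where c: "\<forall>a\<in>X. c a \<in> Field \<mu> \<and> a \<in> under \<kappa> (f (c a))"
      by (rule bchoice[THEN exE])
    \<comment> \<open>Fewer than \<open>\<mu>\<close> indices are bounded in \<open>\<mu>\<close> by
      regularity, and the value of the sequence at the bound lies above all of
      \<open>X\<close>.\<close>
    have "|c ` X| <o \<mu>" using X(2) card_of_image ordLeq_ordLess_trans by blast
    then obtain j where j: "j \<in> Field \<mu>" "c ` X \<subseteq> underS \<mu> j"
      using regular_bounded[OF \<mu>, of "c ` X"] c by blast
    have "X \<subseteq> under \<kappa> (f j)"
    proof
      fix a assume "a \<in> X"
      then have "a \<in> under \<kappa> (f (c a))" "f (c a) \<in> underS \<kappa> (f j)"
        using c j(2) step by blast+
      then show "a \<in> under \<kappa> (f j)"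
        using underS_trans'[OF wo\<kappa>] underS_subset_under by fast
    qed
    then show "\<exists>b\<in>underS \<kappa> \<delta>. X \<subseteq> under \<kappa> b" using f\<delta>[OF j(1)] by blast
  qed
  moreover have "\<delta> \<in> Field \<kappa>" using \<delta>(1) by (simp add: B_def)
  ultimately show ?thesis
    by (intro bexI[of _ \<delta>] exI[of _ f] conjI ballI f\<delta> Hf up)
qed

section \<open>Gregory's diamond\<close>

text \<open>
  If \<open>X\<close> lists all functions on sets \<open>lam \<times> \<gamma>\<close> with \<open>\<gamma> < \<kappa>\<close>, then a function on \<open>lam \<times> \<delta>\<close> whose
  restrictions to \<open>lam \<times> \<gamma>\<close> are listed before \<open>\<delta>\<close> is determined by a map from \<open>\<mu>\<close> to \<open>\<delta>\<close>, for which
  there are only \<open>lam\<close> possibilities. The \<open>i\<close>-th guess reads row \<open>i\<close> off the \<open>i\<close>-th possibility.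
  If all \<open>i\<close> failed, a counterexample to each \<open>i\<close> could be stored in row \<open>i\<close> of one function, whose
  code is listed at some \<open>i\<close>.
\<close>

theorem gregory_diamond:
  fixes \<kappa> :: "'i rel" and \<mu> :: "'m rel" and lam :: "'l rel" and V :: "'v set"
  assumes \<mu>: "Cinfinite \<mu>" "regularCard \<mu>" and \<kappa>: "Cinfinite \<kappa>" "regularCard \<kappa>"
    and lam: "Cinfinite lam" "\<mu> \<le>o lam" "lam <o \<kappa>" "lam ^c \<mu> \<le>o lam"
    and below: "\<And>a. a \<in> Field \<kappa> \<Longrightarrow> |underS \<kappa> a| \<le>o lam"
    and pow: "\<kappa> ^c lam \<le>o \<kappa>" and V: "|V| \<le>o \<kappa>"
  obtains guess :: "'i \<Rightarrow> 'i \<Rightarrow> 'v" where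
    "\<And>F g. F ` Field \<kappa> \<subseteq> V \<Longrightarrow> g ` Field \<kappa> \<subseteq> Field \<kappa> \<Longrightarrow>
       \<exists>\<delta>\<in>Field \<kappa>. cof_ge \<kappa> \<mu> \<delta> \<and>
         (\<forall>a\<in>underS \<kappa> \<delta>. g a \<in> underS \<kappa> \<delta> \<and> guess \<delta> a = F a)"
proof -
  have wo\<kappa>: "Well_order \<kappa>" using \<kappa> by (auto simp: card_order_on_def)
  have lam_Field: "|Field lam| =o lam" using lam(1) card_of_Field_ordIso by blast
  \<comment> \<open>The length \<open>\<gamma>\<close> is stored beside each function, so that a
    decoder can tell whether the function is defined at a given point.\<close>
  define S where "S = (SIGMA \<gamma> : Field \<kappa>. (Field lam \<times> underS \<kappa> \<gamma>) \<rightarrow>\<^sub>E V)"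
  have "|S| \<le>o \<kappa>"
    unfolding S_def
  proof (rule card_of_Sigma_ordLeq_infinite_Field)
    show "\<forall>\<gamma>\<in>Field \<kappa>. |(Field lam \<times> underS \<kappa> \<gamma>) \<rightarrow>\<^sub>E V| \<le>o \<kappa>"
    proof
      fix \<gamma> assume "\<gamma> \<in> Field \<kappa>"
      then have "|Field lam \<times> underS \<kappa> \<gamma>| \<le>o lam"
        using card_of_Times_ordLeq_infinite_Field[of lam] lam(1) below ordIso_imp_ordLeq[OF lam_Field]
        by (auto simp: cinfinite_def)
      then have "|(Field lam \<times> underS \<kappa> \<gamma>) \<rightarrow>\<^sub>E V| \<le>o \<kappa> ^c lam"
        using V \<kappa>(1) lam(1) by (rule card_PiE_le)
      then show "|(Field lam \<times> underS \<kappa> \<gamma>) \<rightarrow>\<^sub>E V| \<le>o \<kappa>" using pow ordLeq_transitive by blast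
    qed
    show "|Field \<kappa>| \<le>o \<kappa>" using \<kappa>(1) card_of_Field_ordIso ordIso_imp_ordLeq by blast
  qed (use \<kappa>(1) in \<open>auto simp: cinfinite_def\<close>)
  then obtain X where X: "S \<subseteq> X ` Field \<kappa>" using ex_covering[of \<kappa> S] \<kappa>(1) by blast
  \<comment> \<open>Here \<open>lam ^c \<mu> \<le>o lam\<close> enters: the maps from
    \<open>\<mu>\<close> into \<open>\<delta>\<close> can be listed in length
    \<open>lam\<close>.\<close>
  have "\<exists>Y. (Field \<mu> \<rightarrow>\<^sub>E underS \<kappa> \<delta>) \<subseteq> Y ` Field lam" if "\<delta> \<in> Field \<kappa>" for \<delta>
  proof (rule ex_covering)
    have "|Field \<mu> \<rightarrow>\<^sub>E underS \<kappa> \<delta>| \<le>o lam ^c \<mu>"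
      using card_of_Field_ordIso[of \<mu>] ordIso_imp_ordLeq below[OF that] lam(1) \<mu>(1)
      by (intro card_PiE_le) auto
    then show "|Field \<mu> \<rightarrow>\<^sub>E underS \<kappa> \<delta>| \<le>o lam" using lam(4) ordLeq_transitive by blast
  qed (use lam in blast)
  then obtain Y where Y: "\<And>\<delta>. \<delta> \<in> Field \<kappa> \<Longrightarrow> (Field \<mu> \<rightarrow>\<^sub>E underS \<kappa> \<delta>) \<subseteq> Y \<delta> ` Field lam"
    by metis
  \<comment> \<open>The values of the map \<open>x\<close> are read as indices into the list
    \<open>X\<close>; some listed function that is long enough to be defined at
    \<open>\<gamma>\<close> is evaluated there, in row \<open>i\<close>.\<close>
  define guess where "guess i \<delta> \<gamma> =
    (let x = Y \<delta> i; j = SOME j. j \<in> Field \<mu> \<and> \<gamma> \<in> underS \<kappa> (fst (X (x j)))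
     in snd (X (x j)) (i, \<gamma>))" for i \<delta> \<gamma>
  let ?good = "\<lambda>i F g. \<exists>\<delta>\<in>Field \<kappa>. cof_ge \<kappa> \<mu> \<delta> \<and>
         (\<forall>a\<in>underS \<kappa> \<delta>. g a \<in> underS \<kappa> \<delta> \<and> guess i \<delta> a = F a)"
  have "\<exists>i\<in>Field lam. \<forall>F g. F ` Field \<kappa> \<subseteq> V \<longrightarrow> g ` Field \<kappa> \<subseteq> Field \<kappa> \<longrightarrow> ?good i F g"
  proof (rule ccontr)
    assume "\<not> ?thesis"
    then have "\<forall>i\<in>Field lam. \<exists>F g. F ` Field \<kappa> \<subseteq> V \<and> g ` Field \<kappa> \<subseteq> Field \<kappa> \<and> \<not> ?good i F g"
      by meson
    then obtain F g where F: "\<And>i. i \<in> Field lam \<Longrightarrow> F i ` Field \<kappa> \<subseteq> V"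
      and g: "\<And>i. i \<in> Field lam \<Longrightarrow> g i ` Field \<kappa> \<subseteq> Field \<kappa>"
      and bad: "\<And>i. i \<in> Field lam \<Longrightarrow> \<not> ?good i (F i) (g i)"
      by metis
    \<comment> \<open>All \<open>lam\<close> counterexamples are packed as the rows of one function,
      of which \<open>p \<gamma>\<close> is the restriction to length
      \<open>\<gamma>\<close>.\<close>
    define p where "p \<gamma> = (\<lambda>(i, \<xi>) \<in> Field lam \<times> underS \<kappa> \<gamma>. F i \<xi>)" for \<gamma>
    have "\<exists>b\<in>Field \<kappa>. X b = (\<gamma>, p \<gamma>)" if "\<gamma> \<in> Field \<kappa>" for \<gamma>
    proof -
      have "F i \<xi> \<in> V" if "i \<in> Field lam" "\<xi> \<in> underS \<kappa> \<gamma>" for i \<xi>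
        using F[OF that(1)] that(2) underS_Field by fast
      then have "(\<gamma>, p \<gamma>) \<in> S" using that by (auto simp: S_def p_def)
      then show ?thesis using X by force
    qed
    then obtain \<beta> where \<beta>: "\<And>\<gamma>. \<gamma> \<in> Field \<kappa> \<Longrightarrow> \<beta> \<gamma> \<in> Field \<kappa> \<and> X (\<beta> \<gamma>) = (\<gamma>, p \<gamma>)"
      by metis
    \<comment> \<open>The row that will be refuted is not known yet, so one bound has to serve the
      maps \<open>g i\<close> of all rows at once; there are at most \<open>lam\<close> values to
      bound.\<close>
    have "\<exists>b\<in>Field \<kappa>. insert (\<beta> \<gamma>) ((\<lambda>(i, \<xi>). g i \<xi>) ` (Field lam \<times> under \<kappa> \<gamma>)) \<subseteq> underS \<kappa> b"
      if \<gamma>: "\<gamma> \<in> Field \<kappa>" for \<gamma>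
    proof (rule regular_bounded[OF \<kappa>])
      let ?A = "(\<lambda>(i, \<xi>). g i \<xi>) ` (Field lam \<times> under \<kappa> \<gamma>)"
      show "insert (\<beta> \<gamma>) ?A \<subseteq> Field \<kappa>"
        using \<beta>[OF \<gamma>] g under_Field[of \<kappa> \<gamma>] by auto
      have inf: "\<not> finite (Field lam)" using lam(1) by (simp add: cinfinite_def)
      have "under \<kappa> \<gamma> = insert \<gamma> (underS \<kappa> \<gamma>)"
        using Refl_under_underS[of \<kappa> \<gamma>] \<gamma> wo\<kappa> by (auto simp: order_on_defs)
      moreover have "|insert \<gamma> (underS \<kappa> \<gamma>)| \<le>o lam"
        using card_insert_le[OF lam(1) below[OF \<gamma>]] .
      ultimately have "|Field lam \<times> under \<kappa> \<gamma>| \<le>o lam"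
        using card_of_Times_ordLeq_infinite_Field[OF inf] lam(1) ordIso_imp_ordLeq[OF lam_Field]
        by auto
      then have "|?A| \<le>o lam" using card_of_image ordLeq_transitive by blast
      then have "|insert (\<beta> \<gamma>) ?A| \<le>o lam"
        by (rule card_insert_le[OF lam(1)])
      then show "|insert (\<beta> \<gamma>) ?A| <o \<kappa>" using lam(3) ordLeq_ordLess_trans by blast
    qed
    then obtain H where H: "\<And>\<gamma>. \<gamma> \<in> Field \<kappa> \<Longrightarrow> H \<gamma> \<in> Field \<kappa> \<and> \<beta> \<gamma> \<in> underS \<kappa> (H \<gamma>) \<and>
        (\<forall>i\<in>Field lam. \<forall>\<xi>\<in>under \<kappa> \<gamma>. g i \<xi> \<in> underS \<kappa> (H \<gamma>))"
      by (simp add: subset_iff image_iff) metis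
    have \<mu>\<kappa>: "\<mu> <o \<kappa>" using lam(2,3) ordLeq_ordLess_trans by blast
    have HF: "H \<gamma> \<in> Field \<kappa>" if "\<gamma> \<in> Field \<kappa>" for \<gamma> using H[OF that] by blast
    obtain \<delta> f where \<delta>: "\<delta> \<in> Field \<kappa>"
      and f: "\<And>j. j \<in> Field \<mu> \<Longrightarrow> f j \<in> underS \<kappa> \<delta>"
      and Hf: "\<And>j. j \<in> Field \<mu> \<Longrightarrow> H (f j) \<in> underS \<kappa> \<delta>"
      and up: "\<And>a. a \<in> underS \<kappa> \<delta> \<Longrightarrow> \<exists>j\<in>Field \<mu>. a \<in> underS \<kappa> (f j)" and cof: "cof_ge \<kappa> \<mu> \<delta>"
      using ex_closed_point[OF \<mu> \<kappa> \<mu>\<kappa>, of H, OF HF] by blast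
    have fF: "f j \<in> Field \<kappa>" if "j \<in> Field \<mu>" for j using f[OF that] underS_Field by fast
    \<comment> \<open>The codes of the restrictions of the packed function along \<open>f\<close>
      form a map from \<open>\<mu>\<close> into \<open>\<delta>\<close>. Its index \<open>i\<close>
      in the list \<open>Y \<delta>\<close> is the row whose counterexample gets refuted.\<close>
    define x where "x = (\<lambda>j\<in>Field \<mu>. \<beta> (f j))"
    have "\<beta> (f j) \<in> underS \<kappa> \<delta>" if "j \<in> Field \<mu>" for j
      using H[OF fF[OF that]] Hf[OF that] underS_trans[OF wo\<kappa>] underS_subset_under by fast
    then have "x \<in> Field \<mu> \<rightarrow>\<^sub>E underS \<kappa> \<delta>" by (auto simp: x_def)
    then obtain i where i: "i \<in> Field lam" "Y \<delta> i = x" using Y[OF \<delta>] by blast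
    have Xx: "X (x j) = (f j, p (f j))" if "j \<in> Field \<mu>" for j
      using that \<beta>[OF fF[OF that]] by (simp add: x_def)
    have "?good i (F i) (g i)"
    proof (intro bexI[OF _ \<delta>] conjI cof ballI)
      fix a assume a: "a \<in> underS \<kappa> \<delta>"
      obtain j where j: "j \<in> Field \<mu>" "a \<in> underS \<kappa> (f j)" using up[OF a] by blast
      show "g i a \<in> underS \<kappa> \<delta>"
        using H[OF fF[OF j(1)]] i(1) j(2) Hf[OF j(1)] underS_trans[OF wo\<kappa>] underS_subset_under
        by fast
      \<comment> \<open>The chosen \<open>j0\<close> may differ from \<open>j\<close>, but all coded
        functions restrict the same function, so they agree at \<open>(i, a)\<close>.\<close>
      define j0 where "j0 = (SOME j. j \<in> Field \<mu> \<and> a \<in> underS \<kappa> (fst (X (x j))))"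
      have "j \<in> Field \<mu> \<and> a \<in> underS \<kappa> (fst (X (x j)))"
        using j Xx by simp
      then have j0: "j0 \<in> Field \<mu> \<and> a \<in> underS \<kappa> (fst (X (x j0)))" unfolding j0_def by (rule someI)
      then have "a \<in> underS \<kappa> (f j0)" using Xx[of j0] by simp
      moreover have "guess i \<delta> a = snd (X (x j0)) (i, a)" by (simp add: guess_def i(2) j0_def Let_def)
      ultimately show "guess i \<delta> a = F i a"
        using Xx j0 i(1) by (simp add: p_def)
    qed
    then show False using bad[OF i(1)] by blast
  qed
  then show ?thesis using that by blast
qed

section \<open>The tree of models\<close>

text \<open>All models of the tree will have their universes inside \<open>U\<close>: it has exactly
  \<open>\<kappa>\<close> elements, enough room for every extension and few enough to be coded by
  ordinals below \<open>\<kappa>\<close>.\<close>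

locale failed_amalgamation =
  fixes \<mu> :: "'m rel" and K :: "('a, 'f, 'r, 'm) aclass" and lam :: "'l rel" and U :: "'a set"
  assumes \<mu>: "Cinfinite \<mu>" "regularCard \<mu>"
    and ac: "mu_abstract_class \<mu> K" and coh: "coherence \<mu> K" and tv: "tarski_vaught \<mu> K"
    and lam: "Cinfinite lam" "\<mu> \<le>o lam" "lam ^c \<mu> \<le>o lam" "ctwo ^c lam =o cardSuc lam"
    and categorical: "\<And>M N. M \<in> Mod_card K lam \<Longrightarrow> N \<in> Mod_card K lam \<Longrightarrow> \<exists>h. iso \<mu> (Lang K) h M N"
    and chains: "\<And>\<delta> :: 'l set rel. Well_order \<delta> \<Longrightarrow> \<delta> <o cardSuc lam \<Longrightarrow> chain_extension K lam \<delta>"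
    and U: "|U| =o cardSuc lam"
    and no_amalgamation: "\<not> amalgamation \<mu> K lam"
begin

abbreviation "\<kappa> \<equiv> cardSuc lam"
abbreviation "L \<equiv> Lang K"

definition small_models :: "('a, 'f, 'r, 'm) struc set" where
  "small_models = {M \<in> Mod_card K lam. univ M \<subseteq> U}"

lemma \<kappa>: "Cinfinite \<kappa>" "regularCard \<kappa>"
  using lam(1) by (simp_all add: Cinfinite_cardSuc regularCard_cardSuc)

lemma wo\<kappa>: "Well_order \<kappa>"
  using \<kappa>(1) by (auto simp: card_order_on_def)

lemma lam_less: "lam <o \<kappa>"
  using lam(1) by (simp add: cardSuc_greater)

lemma below: "a \<in> Field \<kappa> \<Longrightarrow> |underS \<kappa> a| \<le>o lam"
  using card_of_underS[of \<kappa> a] \<kappa>(1) lam(1) cardSuc_ordLeq_ordLess[of lam "|underS \<kappa> a|"]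
  by (simp add: card_of_Card_order)

lemma le_lam_bounded: "X \<subseteq> Field \<kappa> \<Longrightarrow> |X| \<le>o lam \<Longrightarrow> \<exists>b\<in>Field \<kappa>. X \<subseteq> underS \<kappa> b"
  using regular_bounded[OF \<kappa>] lam_less ordLeq_ordLess_trans by blast

lemma Mod_card_lam: "M \<in> Mod_card K lam \<Longrightarrow> M \<in> Mod K \<and> |univ M| \<le>o lam \<and> lam \<le>o |univ M|"
  by (auto simp: Mod_card_def ordIso_iff_ordLeq)

lemma small_modelsD:
  assumes "M \<in> small_models"
  shows "M \<in> Mod_card K lam" "M \<in> Mod K" "|univ M| \<le>o lam" "univ M \<subseteq> U" "is_struc \<mu> L M"
  using assms Mod_card_lam[of M] Mod_is_struc[OF ac] by (auto simp: small_models_def)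

text \<open>Removing at most \<open>lam\<close> points from \<open>U\<close> leaves more than
  \<open>lam\<close>, so the rest of \<open>M\<close> can be placed injectively outside the image of
  \<open>X\<close>.\<close>

lemma extend_into_U:
  assumes M: "M \<in> Mod_card K lam" and X: "X \<subseteq> univ M" "inj_on f X" "f ` X \<subseteq> U"
  obtains g M' where "iso \<mu> L g M M'" "M' \<in> small_models" "\<And>x. x \<in> X \<Longrightarrow> g x = f x"
proof -
  have M_lam: "|univ M| \<le>o lam" using Mod_card_lam[OF M] by blast
  have "|X| \<le>o lam" using card_of_mono1[OF X(1)] M_lam ordLeq_transitive by blast
  then have fX: "|f ` X| \<le>o lam" using card_of_image ordLeq_transitive by blast
  have "\<not> |U - f ` X| \<le>o lam"
  proof
    assume "|U - f ` X| \<le>o lam"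
    then have "|(U - f ` X) \<union> f ` X| \<le>o lam"
      using fX lam(1) by (intro card_of_Un_ordLeq_infinite_Field) (auto simp: cinfinite_def)
    then have "|U| \<le>o lam" using X(3) by (simp add: Un_absorb2)
    then have "\<kappa> \<le>o lam" using U ordIso_symmetric ordIso_ordLeq_trans by blast
    then show False using lam_less not_ordLess_ordLeq by blast
  qed
  then have "lam \<le>o |U - f ` X|"
    using lam(1) by (meson card_of_Well_order card_order_on_def not_ordLeq_iff_ordLess ordLess_imp_ordLeq)
  moreover have "|univ M - X| \<le>o lam"
    using card_of_mono1[of "univ M - X" "univ M"] M_lam ordLeq_transitive by blast
  ultimately have "|univ M - X| \<le>o |U - f ` X|" using ordLeq_transitive by blast
  then obtain f' where f': "inj_on f' (univ M - X)" "f' ` (univ M - X) \<subseteq> U - f ` X"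
    using card_of_ordLeq[of "univ M - X" "U - f ` X"] by blast
  define g where "g x = (if x \<in> X then f x else f' x)" for x
  have "inj_on g (univ M)"
  proof (rule inj_onI)
    fix x y assume *: "x \<in> univ M" "y \<in> univ M" "g x = g y"
    have f'_X: "f' u \<notin> f ` X" if "u \<in> univ M - X" for u using f'(2) that by blast
    show "x = y"
    proof (cases "x \<in> X"; cases "y \<in> X")
      assume "x \<in> X" "y \<in> X"
      then show ?thesis using X(2) *(3) by (simp add: g_def inj_on_eq_iff)
    next
      assume "x \<notin> X" "y \<notin> X"
      then show ?thesis using f'(1) * by (simp add: g_def inj_on_eq_iff)
    next
      assume "x \<in> X" "y \<notin> X"
      then have "f' y = f x" using *(3) by (simp add: g_def)
      then have "f' y \<in> f ` X" using \<open>x \<in> X\<close> by simp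
      then show ?thesis using f'_X *(2) \<open>y \<notin> X\<close> by blast
    next
      assume "x \<notin> X" "y \<in> X"
      then have "f' x = f y" using *(3) by (simp add: g_def)
      then have "f' x \<in> f ` X" using \<open>y \<in> X\<close> by simp
      then show ?thesis using f'_X *(1) \<open>x \<notin> X\<close> by blast
    qed
  qed
  moreover have "is_struc \<mu> L M" using Mod_is_struc[OF ac] Mod_card_lam[OF M] by blast
  ultimately obtain M' where M': "iso \<mu> L g M M'" using ex_iso_image by blast
  have "univ M' \<subseteq> U"
    using iso_strucD(5)[OF M'] X(3) f'(2) by (force simp: g_def)
  moreover have "M' \<in> Mod_card K lam" using Mod_card_iso[OF ac M M'] .
  ultimately show ?thesis using that[OF M'] by (simp add: small_models_def g_def)
qed

section \<open>Extensions of small models that cannot be amalgamated\<close>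

definition non_amalgamable ::
  "('a \<Rightarrow> 'a) \<Rightarrow> ('a, 'f, 'r, 'm) struc \<Rightarrow> ('a, 'f, 'r, 'm) struc \<Rightarrow> ('a, 'f, 'r, 'm) struc \<Rightarrow> bool" where
  "non_amalgamable h P A B \<longleftrightarrow> \<not> (\<exists>N\<in>Mod_card K lam. \<exists>g1 g2.
     K_embedding \<mu> K g1 A N \<and> K_embedding \<mu> K g2 B N \<and> (\<forall>x\<in>univ P. g1 x = g2 (h x)))"

text \<open>Strict growth at every level is what gives the branches cardinality
  \<open>\<kappa>\<close>.\<close>

definition proper_ext :: "('a, 'f, 'r, 'm) struc rel" where
  "proper_ext = {(P, A) \<in> Le K. A \<in> small_models \<and> univ P \<subset> univ A}"

text \<open>By categoricity the base \<open>M0\<close> of a failing triple is isomorphic to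
  \<open>P\<close> through some \<open>f\<close>. Then \<open>M1\<close> is copied to
  \<open>A\<close> along \<open>f\<close> and \<open>M2\<close> to \<open>B\<close> along
  \<open>h\<close> after \<open>f\<close>; amalgamating the copies over \<open>h\<close> would
  amalgamate the triple.\<close>

lemma ex_non_amalgamable:
  assumes P: "P \<in> small_models" and Q: "Q \<in> small_models" and h: "iso \<mu> L h P Q"
  shows "\<exists>A B. (P, A) \<in> proper_ext \<and> (Q, B) \<in> proper_ext \<and> non_amalgamable h P A B"
proof -
  obtain M0 M1 M2 where M: "M0 \<in> Mod_card K lam" "M1 \<in> Mod_card K lam" "M2 \<in> Mod_card K lam"
    "(M0, M1) \<in> Le K" "(M0, M2) \<in> Le K"
    and bad: "\<And>N g1 g2. N \<in> Mod_card K lam \<Longrightarrow> K_embedding \<mu> K g1 M1 N \<Longrightarrow> K_embedding \<mu> K g2 M2 N \<Longrightarrow>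
       \<exists>x\<in>univ M0. g1 x \<noteq> g2 x"
    using no_amalgamation unfolding amalgamation_def by metis
  obtain f where f: "iso \<mu> L f M0 P" using categorical[OF M(1) small_modelsD(1)[OF P]] by blast
  have hf: "iso \<mu> L (\<lambda>x. h (f x)) M0 Q" using iso_compose[OF f h] .
  note D1 = iso_strucD[OF f] and D2 = iso_strucD[OF hf]
  obtain f1 A where A: "iso \<mu> L f1 M1 A" "A \<in> small_models" "\<And>x. x \<in> univ M0 \<Longrightarrow> f1 x = f x"
    using extend_into_U[OF M(2) Le_ModD(4)[OF ac M(4)] D1(4)] D1(5) small_modelsD(4)[OF P] by metis
  obtain f2 B where B: "iso \<mu> L f2 M2 B" "B \<in> small_models" "\<And>x. x \<in> univ M0 \<Longrightarrow> f2 x = h (f x)"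
    using extend_into_U[OF M(3) Le_ModD(4)[OF ac M(5)] D2(4)] D2(5) small_modelsD(4)[OF Q] by metis
  have PA: "(P, A) \<in> Le K"
    using iso_Le_iso[OF ac M(4) A(1) iso_cong[OF f]] A(3) by metis
  have QB: "(Q, B) \<in> Le K"
    using iso_Le_iso[OF ac M(5) B(1) iso_cong[OF hf]] B(3) by metis
  have na: "non_amalgamable h P A B"
    unfolding non_amalgamable_def
  proof (intro notI, elim bexE exE conjE)
    fix N g1 g2
    assume N: "N \<in> Mod_card K lam" "K_embedding \<mu> K g1 A N" "K_embedding \<mu> K g2 B N"
      and eq: "\<forall>x\<in>univ P. g1 x = g2 (h x)"
    obtain x where "x \<in> univ M0" "g1 (f1 x) \<noteq> g2 (f2 x)"
      using bad[OF N(1) K_embedding_iso[OF A(1) N(2)] K_embedding_iso[OF B(1) N(3)]] by blast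
    moreover from this have "f x \<in> univ P" using D1(5) by blast
    ultimately show False using A(3) B(3) eq by simp
  qed
  \<comment> \<open>Properness is automatic: were \<open>A\<close> equal to \<open>P\<close>, then
    \<open>h\<close> and the identity would amalgamate \<open>A\<close> and \<open>B\<close> inside
    \<open>B\<close>. The other side uses the inverse of \<open>h\<close> inside
    \<open>A\<close>.\<close>
  have "univ P \<noteq> univ A"
  proof
    assume "univ P = univ A"
    then have "A = P" using substruc_eqI[OF Le_ModD(3)[OF ac PA]] by simp
    then have "K_embedding \<mu> K h A B" using h QB unfolding K_embedding_def by blast
    then show False
      using na K_embedding_id[OF ac Le_refl[OF ac]] small_modelsD(1,2)[OF B(2)]
      unfolding non_amalgamable_def by blast
  qed
  moreover have "univ Q \<noteq> univ B"
  proof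
    let ?h = "inv_into (univ P) h"
    assume "univ Q = univ B"
    then have "B = Q" using substruc_eqI[OF Le_ModD(3)[OF ac QB]] by simp
    then have "K_embedding \<mu> K ?h B A"
      using iso_inverse[OF h] PA unfolding K_embedding_def by blast
    moreover have "\<forall>x\<in>univ P. x = ?h (h x)" using iso_strucD(4)[OF h] by simp
    ultimately show False
      using na K_embedding_id[OF ac Le_refl[OF ac]] small_modelsD(1,2)[OF A(2)]
      unfolding non_amalgamable_def by blast
  qed
  ultimately show ?thesis
    using na PA QB A(2) B(2) Le_ModD(4)[OF ac PA] Le_ModD(4)[OF ac QB]
    unfolding proper_ext_def by blast
qed

lemma ex_proper_ext: "P \<in> small_models \<Longrightarrow> \<exists>A. (P, A) \<in> proper_ext"
  using ex_non_amalgamable[OF _ _ iso_id] small_modelsD(5) by blast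

text \<open>Where the predecessors are directed the bound has to be the union itself, so that an
  isomorphism closed below \<open>\<alpha>\<close> restricts to it. Elsewhere any bound serves; at
  the least point this is an arbitrary small model, the root of the tree.\<close>

definition chain_bound :: "'l set \<Rightarrow> ('l set \<Rightarrow> ('a, 'f, 'r, 'm) struc) \<Rightarrow> ('a, 'f, 'r, 'm) struc" where
  "chain_bound \<alpha> C =
     (if cof_ge \<kappa> \<mu> \<alpha> then union_struc \<mu> L (C ` underS \<kappa> \<alpha>) (\<lambda>x. x)
      else SOME N. N \<in> small_models \<and> (\<forall>\<beta>\<in>underS \<kappa> \<alpha>. (C \<beta>, N) \<in> Le K))"

lemma chain_bound_cong:
  assumes "\<And>\<beta>. \<beta> \<in> underS \<kappa> \<alpha> \<Longrightarrow> C \<beta> = C' \<beta>"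
  shows "chain_bound \<alpha> C = chain_bound \<alpha> C'"
proof -
  have "C ` underS \<kappa> \<alpha> = C' ` underS \<kappa> \<alpha>" using assms by simp
  then show ?thesis using assms by (simp add: chain_bound_def)
qed

context
  fixes \<alpha> C
  assumes \<alpha>: "\<alpha> \<in> Field \<kappa>"
    and C: "\<And>\<beta>. \<beta> \<in> underS \<kappa> \<alpha> \<Longrightarrow> C \<beta> \<in> small_models"
    and mono: "\<And>\<gamma> \<beta>. \<gamma> \<in> underS \<kappa> \<beta> \<Longrightarrow> \<beta> \<in> underS \<kappa> \<alpha> \<Longrightarrow> (C \<gamma>, C \<beta>) \<in> Le K"
begin

lemma mono_under: "\<gamma> \<in> under \<kappa> \<beta> \<Longrightarrow> \<beta> \<in> underS \<kappa> \<alpha> \<Longrightarrow> (C \<gamma>, C \<beta>) \<in> Le K"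
  using mono[of \<gamma> \<beta>] Le_refl[OF ac small_modelsD(2)[OF C]]
  by (cases "\<gamma> = \<beta>") (auto simp: under_def underS_def)

lemma union_below: "|\<Union>\<beta>\<in>underS \<kappa> \<alpha>. univ (C \<beta>)| \<le>o lam"
  using lam(1) below[OF \<alpha>] small_modelsD(3)[OF C]
  by (intro card_of_UNION_ordLeq_infinite_Field) (auto simp: cinfinite_def)

lemma chain_bound_limit:
  assumes cof: "cof_ge \<kappa> \<mu> \<alpha>"
  shows "univ (chain_bound \<alpha> C) = (\<Union>\<beta>\<in>underS \<kappa> \<alpha>. univ (C \<beta>))"
    "chain_bound \<alpha> C \<in> small_models" "\<And>\<beta>. \<beta> \<in> underS \<kappa> \<alpha> \<Longrightarrow> (C \<beta>, chain_bound \<alpha> C) \<in> Le K"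
proof -
  let ?N = "chain_bound \<alpha> C"
  have N_eq: "?N = union_struc \<mu> L (C ` underS \<kappa> \<alpha>) (\<lambda>x. x)"
    using cof by (simp add: chain_bound_def)
  have dir: "\<exists>j\<in>underS \<kappa> \<alpha>. \<forall>i\<in>S. (C i, C j) \<in> Le K" if S: "S \<subseteq> underS \<kappa> \<alpha>" "|S| <o \<mu>" for S
  proof -
    obtain j where j: "j \<in> underS \<kappa> \<alpha>" "S \<subseteq> under \<kappa> j" using cof_geD[OF cof S] .
    have "\<forall>i\<in>S. (C i, C j) \<in> Le K" using mono_under[OF _ j(1)] j(2) by (auto dest: subsetD)
    then show ?thesis using j(1) by (rule bexI)
  qed
  note D = directed_union[OF ac tv, of "underS \<kappa> \<alpha>" C, OF small_modelsD(2)[OF C] dir, folded N_eq]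
  show u: "univ ?N = (\<Union>\<beta>\<in>underS \<kappa> \<alpha>. univ (C \<beta>))" using D(2) by blast
  show Le: "(C \<beta>, ?N) \<in> Le K" if "\<beta> \<in> underS \<kappa> \<alpha>" for \<beta> using D(3) that by blast
  obtain \<beta> where \<beta>: "\<beta> \<in> underS \<kappa> \<alpha>" using cof_ge_nonempty[OF \<mu>(1) cof] .
  have "lam \<le>o |univ ?N|"
    using Mod_card_lam[OF small_modelsD(1)[OF C[OF \<beta>]]] card_of_mono1[OF Le_ModD(4)[OF ac Le[OF \<beta>]]]
      ordLeq_transitive by blast
  moreover have "|univ ?N| \<le>o lam" using union_below u by simp
  moreover have "?N \<in> Mod K" using D(1) by blast
  moreover have "univ ?N \<subseteq> U" using u small_modelsD(4)[OF C] by blast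
  ultimately show "?N \<in> small_models"
    by (simp add: small_models_def Mod_card_def ordIso_iff_ordLeq)
qed

lemma ex_chain_bound: "\<exists>N. N \<in> small_models \<and> (\<forall>\<beta>\<in>underS \<kappa> \<alpha>. (C \<beta>, N) \<in> Le K)"
proof -
  let ?r = "Restr \<kappa> (underS \<kappa> \<alpha>)"
  have Fr: "Field ?r = underS \<kappa> \<alpha>"
    using wo\<kappa> underS_Field[of _ \<kappa> \<alpha>] by (intro Refl_Field_Restr2) (auto simp: order_on_defs)
  have "Well_order ?r" using Well_order_Restr[OF wo\<kappa>] .
  moreover have "?r <o \<kappa>" using underS_Restr_ordLess[OF wo\<kappa>] \<alpha> by blast
  ultimately have "chain_extension K lam ?r" by (rule chains)
  moreover have "\<forall>(i, j)\<in>?r. (C i, C j) \<in> Le K" using mono_under by (auto simp: under_def)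
  moreover have "\<forall>i\<in>Field ?r. C i \<in> Mod_card K lam" using small_modelsD(1)[OF C] Fr by blast
  ultimately obtain M where M: "M \<in> Mod_card K lam" "\<And>\<beta>. \<beta> \<in> underS \<kappa> \<alpha> \<Longrightarrow> (C \<beta>, M) \<in> Le K"
    unfolding chain_extension_def Fr by blast
  let ?X = "\<Union>\<beta>\<in>underS \<kappa> \<alpha>. univ (C \<beta>)"
  have X: "?X \<subseteq> univ M" using Le_ModD(4)[OF ac M(2)] by blast
  have XU: "(\<lambda>x. x) ` ?X \<subseteq> U" using small_modelsD(4)[OF C] by blast
  \<comment> \<open>The bound \<open>M\<close> may leave \<open>U\<close>; it is moved into
    \<open>U\<close> with the union of the chain held fixed.\<close>
  obtain g N where N: "iso \<mu> L g M N" "N \<in> small_models" "\<And>x. x \<in> ?X \<Longrightarrow> g x = x"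
    using extend_into_U[OF M(1) X _ XU] by (metis inj_on_id2)
  have "(C \<beta>, N) \<in> Le K" if "\<beta> \<in> underS \<kappa> \<alpha>" for \<beta>
  proof (rule iso_Le_iso[OF ac M(2)[OF that] N(1)])
    have "g u = u" if "u \<in> univ (C \<beta>)" for u using N(3)[of u] that \<open>\<beta> \<in> _\<close> by blast
    then show "iso \<mu> L g (C \<beta>) (C \<beta>)"
      using iso_cong[OF iso_id[OF small_modelsD(5)[OF C[OF that]]], of g] by simp
  qed
  then show ?thesis using N(2) by blast
qed

lemma chain_bound:
  "chain_bound \<alpha> C \<in> small_models" "\<And>\<beta>. \<beta> \<in> underS \<kappa> \<alpha> \<Longrightarrow> (C \<beta>, chain_bound \<alpha> C) \<in> Le K"
proof -
  have "chain_bound \<alpha> C \<in> small_models \<and> (\<forall>\<beta>\<in>underS \<kappa> \<alpha>. (C \<beta>, chain_bound \<alpha> C) \<in> Le K)"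
  proof (cases "cof_ge \<kappa> \<mu> \<alpha>")
    case True
    then show ?thesis using chain_bound_limit by blast
  next
    case False
    then show ?thesis using someI_ex[OF ex_chain_bound] by (simp add: chain_bound_def)
  qed
  then show "chain_bound \<alpha> C \<in> small_models"
    "\<And>\<beta>. \<beta> \<in> underS \<kappa> \<alpha> \<Longrightarrow> (C \<beta>, chain_bound \<alpha> C) \<in> Le K" by auto
qed

end

end

text \<open>
  A branch of the tree is a set \<open>E \<subseteq> \<kappa>\<close>. At level \<open>\<delta>\<close> the diamond guesses two branches and a map
  between the models built along them below \<open>\<delta>\<close>; the map is read through the bijection \<open>e\<close>.
\<close>

locale guessed_tree = failed_amalgamation \<mu> K lam U
  for \<mu> :: "'m rel" and K :: "('a, 'f, 'r, 'm) aclass" and lam :: "'l rel" and U :: "'a set" +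
  fixes guess :: "'l set \<Rightarrow> 'l set \<Rightarrow> bool \<times> bool \<times> 'a" and e :: "'l set \<Rightarrow> 'a"
  assumes e: "bij_betw e (Field \<kappa>) U"
    and guess: "\<And>F g. F ` Field \<kappa> \<subseteq> UNIV \<times> UNIV \<times> U \<Longrightarrow> g ` Field \<kappa> \<subseteq> Field \<kappa> \<Longrightarrow>
       \<exists>\<delta>\<in>Field \<kappa>. cof_ge \<kappa> \<mu> \<delta> \<and> (\<forall>a\<in>underS \<kappa> \<delta>. g a \<in> underS \<kappa> \<delta> \<and> guess \<delta> a = F a)"
begin

definition code :: "'a \<Rightarrow> 'l set" where "code = inv_into (Field \<kappa>) e"

lemma code: "u \<in> U \<Longrightarrow> code u \<in> Field \<kappa>" "u \<in> U \<Longrightarrow> e (code u) = u"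
  using e by (auto simp: code_def bij_betw_def inv_into_into f_inv_into_f)

definition guess1 :: "'l set \<Rightarrow> 'l set set" where
  "guess1 \<delta> = {a \<in> underS \<kappa> \<delta>. fst (guess \<delta> a)}"

definition guess2 :: "'l set \<Rightarrow> 'l set set" where
  "guess2 \<delta> = {a \<in> underS \<kappa> \<delta>. fst (snd (guess \<delta> a))}"

definition guess_map :: "'l set \<Rightarrow> 'a \<Rightarrow> 'a" where
  "guess_map \<delta> u = snd (snd (guess \<delta> (code u)))"

definition split_pair ::
  "('a \<Rightarrow> 'a) \<Rightarrow> ('a, 'f, 'r, 'm) struc \<Rightarrow> ('a, 'f, 'r, 'm) struc \<Rightarrow>
   ('a, 'f, 'r, 'm) struc \<times> ('a, 'f, 'r, 'm) struc" where
  "split_pair h P Q = (SOME (A, B). (P, A) \<in> proper_ext \<and> (Q, B) \<in> proper_ext \<and> non_amalgamable h P A B)"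

lemma split_pair:
  assumes "P \<in> small_models" "Q \<in> small_models" "iso \<mu> L h P Q" "split_pair h P Q = (A, B)"
  shows "(P, A) \<in> proper_ext" "(Q, B) \<in> proper_ext" "non_amalgamable h P A B"
proof -
  have "\<exists>x. case x of (A, B) \<Rightarrow>
      (P, A) \<in> proper_ext \<and> (Q, B) \<in> proper_ext \<and> non_amalgamable h P A B"
    using ex_non_amalgamable[OF assms(1-3)] by auto
  from someI_ex[OF this] show "(P, A) \<in> proper_ext" "(Q, B) \<in> proper_ext" "non_amalgamable h P A B"
    unfolding split_pair_def[symmetric] assms(4) by auto
qed

text \<open>Distinctness of the two guessed branches keeps the two prescriptions in
  \<open>next_model\<close> from colliding.\<close>

definition guess_active :: "'l set \<Rightarrow> ('l set set \<Rightarrow> ('a, 'f, 'r, 'm) struc) \<Rightarrow> bool" where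
  "guess_active \<delta> B \<longleftrightarrow>
     guess1 \<delta> \<noteq> guess2 \<delta> \<and> iso \<mu> L (guess_map \<delta>) (B (guess1 \<delta>)) (B (guess2 \<delta>))"

definition next_model ::
  "'l set \<Rightarrow> ('l set set \<Rightarrow> ('a, 'f, 'r, 'm) struc) \<Rightarrow> 'l set set \<Rightarrow> ('a, 'f, 'r, 'm) struc" where
  "next_model \<delta> B E =
     (if guess_active \<delta> B \<and> E = guess1 \<delta> then
        fst (split_pair (guess_map \<delta>) (B (guess1 \<delta>)) (B (guess2 \<delta>)))
      else if guess_active \<delta> B \<and> E = guess2 \<delta> then
        snd (split_pair (guess_map \<delta>) (B (guess1 \<delta>)) (B (guess2 \<delta>)))
      else SOME A. (B E, A) \<in> proper_ext)"

lemma next_model: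
  assumes "\<And>E. B E \<in> small_models"
  shows "(B E, next_model \<delta> B E) \<in> proper_ext"
proof -
  have "(B E, SOME A. (B E, A) \<in> proper_ext) \<in> proper_ext"
    using someI_ex[OF ex_proper_ext[OF assms[of E]]] .
  moreover obtain A1 A2 where
    "split_pair (guess_map \<delta>) (B (guess1 \<delta>)) (B (guess2 \<delta>)) = (A1, A2)" by fastforce
  ultimately show ?thesis
    using split_pair[OF assms assms, of "guess_map \<delta>" "guess1 \<delta>" "guess2 \<delta>"]
    by (auto simp: next_model_def guess_active_def)
qed

definition tree :: "'l set \<Rightarrow> 'l set set \<Rightarrow> ('a, 'f, 'r, 'm) struc" where
  "tree = wfrec (\<kappa> - Id) (\<lambda>T \<delta> E.
     next_model \<delta> (\<lambda>E'. chain_bound \<delta> (\<lambda>\<beta>. T \<beta> E')) (E \<inter> underS \<kappa> \<delta>))"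

text \<open>At each level \<open>base\<close> is the model that enters it, a bound of the earlier
  levels, and \<open>tree\<close> the proper extension that leaves it.\<close>

definition base :: "'l set \<Rightarrow> 'l set set \<Rightarrow> ('a, 'f, 'r, 'm) struc" where
  "base \<delta> E = chain_bound \<delta> (\<lambda>\<beta>. tree \<beta> E)"

lemma tree_eq: "tree \<delta> E = next_model \<delta> (base \<delta>) (E \<inter> underS \<kappa> \<delta>)"
proof -
  let ?F = "\<lambda>T \<delta> E. next_model \<delta> (\<lambda>E'. chain_bound \<delta> (\<lambda>\<beta>. T \<beta> E')) (E \<inter> underS \<kappa> \<delta>)"
  have "adm_wf (\<kappa> - Id) ?F"
    unfolding adm_wf_def
  proof (intro allI impI)
    fix T T' :: "'l set \<Rightarrow> 'l set set \<Rightarrow> ('a, 'f, 'r, 'm) struc" and \<delta>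
    assume "\<forall>z. (z, \<delta>) \<in> \<kappa> - Id \<longrightarrow> T z = T' z"
    then have "chain_bound \<delta> (\<lambda>\<beta>. T \<beta> E') = chain_bound \<delta> (\<lambda>\<beta>. T' \<beta> E')" for E'
      by (intro chain_bound_cong) (simp add: underS_iff)
    then show "?F T \<delta> = ?F T' \<delta>" by simp
  qed
  then have "tree = ?F tree"
    unfolding tree_def by (rule wfrec_fixpoint[OF wf_strict[OF wo\<kappa>]])
  then show ?thesis unfolding base_def by metis
qed

text \<open>In the unfolded recursion \<open>E\<close> occurs only through its part below
  \<open>\<beta>\<close>. Hence guessing a branch below \<open>\<delta>\<close> is enough to know
  its base at \<open>\<delta>\<close>.\<close>

lemma tree_restrict:
  assumes "\<beta> \<in> under \<kappa> \<delta>"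
  shows "tree \<beta> (E \<inter> underS \<kappa> \<delta>) = tree \<beta> E"
proof -
  have "underS \<kappa> \<beta> \<subseteq> underS \<kappa> \<delta>" using underS_trans[OF wo\<kappa> _ assms] by blast
  then have "E \<inter> underS \<kappa> \<delta> \<inter> underS \<kappa> \<beta> = E \<inter> underS \<kappa> \<beta>" by blast
  then show ?thesis by (simp add: tree_eq[of \<beta>])
qed

lemma base_restrict: "base \<delta> (E \<inter> underS \<kappa> \<delta>) = base \<delta> E"
  unfolding base_def
  by (intro chain_bound_cong tree_restrict) (use underS_subset_under in fast)

text \<open>The induction runs over all branches together, because \<open>next_model\<close>
  consults the bases of both guessed branches whichever branch is being extended.\<close>

lemma tree_chain:
  assumes "\<delta> \<in> Field \<kappa>"
  shows "base \<delta> E \<in> small_models \<and> tree \<delta> E \<in> small_models \<and> (base \<delta> E, tree \<delta> E) \<in> proper_ext \<and>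
    (\<forall>\<beta>\<in>underS \<kappa> \<delta>. (tree \<beta> E, base \<delta> E) \<in> Le K \<and> (tree \<beta> E, tree \<delta> E) \<in> Le K)"
  using assms
proof (induction \<delta> arbitrary: E rule: wf_induct_rule[OF wf_strict[OF wo\<kappa>]])
  case (1 \<delta>)
  have IH: "tree \<beta> E \<in> small_models \<and> (\<forall>\<gamma>\<in>underS \<kappa> \<beta>. (tree \<gamma> E, tree \<beta> E) \<in> Le K)"
    if "\<beta> \<in> underS \<kappa> \<delta>" for \<beta> E
    using 1(1)[of \<beta> E] that underS_Field[OF that] by (simp add: underS_iff)
  have b: "base \<delta> E \<in> small_models" "\<And>\<beta>. \<beta> \<in> underS \<kappa> \<delta> \<Longrightarrow> (tree \<beta> E, base \<delta> E) \<in> Le K" for E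
    using chain_bound[OF 1(2), of "\<lambda>\<beta>. tree \<beta> E"] IH unfolding base_def by blast+
  have "(base \<delta> E, tree \<delta> E) \<in> proper_ext"
    using next_model[of "base \<delta>" "E \<inter> underS \<kappa> \<delta>" \<delta>, OF b(1)]
    unfolding tree_eq[of \<delta> E] base_restrict .
  then show ?case
    using b Le_trans[OF ac] unfolding proper_ext_def by blast
qed

lemma univ_base:
  assumes "\<delta> \<in> Field \<kappa>" "cof_ge \<kappa> \<mu> \<delta>"
  shows "univ (base \<delta> E) = (\<Union>\<beta>\<in>underS \<kappa> \<delta>. univ (tree \<beta> E))"
  unfolding base_def
proof (rule chain_bound_limit(1)[OF assms(1) _ _ assms(2)])
  show "tree \<beta> E \<in> small_models" if "\<beta> \<in> underS \<kappa> \<delta>" for \<beta>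
    using tree_chain underS_Field[OF that] by blast
  show "(tree \<gamma> E, tree \<beta> E) \<in> Le K" if "\<gamma> \<in> underS \<kappa> \<beta>" "\<beta> \<in> underS \<kappa> \<delta>" for \<gamma> \<beta>
    using tree_chain[OF underS_Field[OF that(2)]] that(1) by blast
qed

section \<open>Models of cardinality \<open>\<kappa>\<close> as unions along branches\<close>

definition branch :: "'l set set \<Rightarrow> ('a, 'f, 'r, 'm) struc" where
  "branch E = union_struc \<mu> L ((\<lambda>\<alpha>. tree \<alpha> E) ` Field \<kappa>) (\<lambda>x. x)"

lemma branch:
  shows "branch E \<in> Mod K" "univ (branch E) = (\<Union>\<alpha>\<in>Field \<kappa>. univ (tree \<alpha> E))"
    "\<And>\<alpha>. \<alpha> \<in> Field \<kappa> \<Longrightarrow> (tree \<alpha> E, branch E) \<in> Le K"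
proof -
  have dir: "\<exists>j\<in>Field \<kappa>. \<forall>i\<in>S. (tree i E, tree j E) \<in> Le K" if S: "S \<subseteq> Field \<kappa>" "|S| <o \<mu>" for S
  proof -
    have "|S| \<le>o lam" using S(2) lam(2) ordLess_imp_ordLeq ordLeq_transitive by blast
    then obtain b where "b \<in> Field \<kappa>" "S \<subseteq> underS \<kappa> b" using le_lam_bounded[OF S(1)] by blast
    then show ?thesis using tree_chain by blast
  qed
  have Mod: "tree \<alpha> E \<in> Mod K" if "\<alpha> \<in> Field \<kappa>" for \<alpha>
    using tree_chain[OF that] small_modelsD(2) by blast
  note D = directed_union[OF ac tv, of "Field \<kappa>" "\<lambda>\<alpha>. tree \<alpha> E", OF Mod dir, folded branch_def]
  show "branch E \<in> Mod K" "univ (branch E) = (\<Union>\<alpha>\<in>Field \<kappa>. univ (tree \<alpha> E))"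
    "\<And>\<alpha>. \<alpha> \<in> Field \<kappa> \<Longrightarrow> (tree \<alpha> E, branch E) \<in> Le K"
    using D(1-3) by blast+
qed

text \<open>Each level contributes an element outside its base. All earlier levels lie inside that
  base, so these elements are pairwise distinct.\<close>

lemma branch_card: "branch E \<in> Mod_card K \<kappa>"
proof -
  have \<kappa>_Field: "|Field \<kappa>| =o \<kappa>" using \<kappa>(1) card_of_Field_ordIso by blast
  have tU: "univ (tree \<alpha> E) \<subseteq> U" if "\<alpha> \<in> Field \<kappa>" for \<alpha>
    using tree_chain[OF that] small_modelsD(4) by blast
  have "univ (branch E) \<subseteq> U" unfolding branch(2) using tU by blast
  then have "|univ (branch E)| \<le>o \<kappa>"
    using card_of_mono1 U ordLeq_ordIso_trans by blast
  moreover have "\<kappa> \<le>o |univ (branch E)|"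
  proof -
    have "\<exists>u. u \<in> univ (tree \<alpha> E) - univ (base \<alpha> E)" if "\<alpha> \<in> Field \<kappa>" for \<alpha>
      using tree_chain[OF that, of E] unfolding proper_ext_def by blast
    then obtain c where c: "\<And>\<alpha>. \<alpha> \<in> Field \<kappa> \<Longrightarrow> c \<alpha> \<in> univ (tree \<alpha> E) - univ (base \<alpha> E)" by metis
    have ne: "c \<beta> \<noteq> c \<alpha>" if "\<alpha> \<in> Field \<kappa>" "\<beta> \<in> underS \<kappa> \<alpha>" for \<alpha> \<beta>
    proof -
      have "univ (tree \<beta> E) \<subseteq> univ (base \<alpha> E)"
        using tree_chain[OF that(1), of E] that(2) Le_ModD(4)[OF ac] by blast
      then show ?thesis using c[OF that(1)] c[OF underS_Field[OF that(2)]] by auto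
    qed
    have "inj_on c (Field \<kappa>)"
    proof (rule inj_onI)
      fix \<alpha> \<beta> assume *: "\<alpha> \<in> Field \<kappa>" "\<beta> \<in> Field \<kappa>" "c \<alpha> = c \<beta>"
      have "\<alpha> \<in> underS \<kappa> \<beta> \<or> \<beta> \<in> underS \<kappa> \<alpha> \<or> \<alpha> = \<beta>"
        using underS_linear[OF wo\<kappa> *(1,2)] by (auto simp: under_def underS_def)
      then show "\<alpha> = \<beta>" using ne * by metis
    qed
    moreover have "c ` Field \<kappa> \<subseteq> univ (branch E)" unfolding branch(2) using c by blast
    ultimately have "|Field \<kappa>| \<le>o |univ (branch E)|" using card_of_ordLeq by blast
    then show ?thesis using \<kappa>_Field ordIso_symmetric ordIso_ordLeq_trans by blast
  qed
  ultimately show ?thesis using branch(1) by (simp add: Mod_card_def ordIso_iff_ordLeq)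
qed

text \<open>
  An isomorphism of two branches is guessed at some \<open>\<delta>\<close> closed under the isomorphism, where the
  branches were continued by models that are not amalgamable along it.
\<close>

lemma branch_not_iso:
  assumes E: "E \<subseteq> Field \<kappa>" "E' \<subseteq> Field \<kappa>" "E \<noteq> E'"
  shows "\<not> iso \<mu> L h (branch E) (branch E')"
proof
  assume h: "iso \<mu> L h (branch E) (branch E')"
  let ?k = "inv_into (univ (branch E)) h"
  note hD = iso_strucD[OF h]
  obtain c where c: "c \<in> Field \<kappa>" "c \<in> E \<longleftrightarrow> c \<notin> E'" using E by blast
  have tU: "univ (tree \<alpha> D) \<subseteq> U" and tlam: "|univ (tree \<alpha> D)| \<le>o lam" if "\<alpha> \<in> Field \<kappa>" for \<alpha> D
    using tree_chain[OF that] small_modelsD(3,4) by blast+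
  have tb: "univ (tree \<alpha> D) \<subseteq> univ (branch D)" if "\<alpha> \<in> Field \<kappa>" for \<alpha> D
    using branch(2) that by blast
  have hb: "h u \<in> univ (branch E')" if "u \<in> univ (branch E)" for u using hD(5) that by blast
  have kb: "?k u \<in> univ (branch E)" "h (?k u) = u" if "u \<in> univ (branch E')" for u
    using hD(5) that by (auto intro: inv_into_into f_inv_into_f)
  \<comment> \<open>\<open>lev D u\<close> is a level of the branch \<open>D\<close> at which
    \<open>u\<close> is already present.\<close>
  have "\<forall>D. \<exists>lev. \<forall>u\<in>univ (branch D). lev u \<in> Field \<kappa> \<and> u \<in> univ (tree (lev u) D)"
    unfolding branch(2) by (intro allI bchoice) blast
  then obtain lev where lev: "\<And>D u. u \<in> univ (branch D) \<Longrightarrow>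
      lev D u \<in> Field \<kappa> \<and> u \<in> univ (tree (lev D u) D)" by metis
  \<comment> \<open>\<open>G\<close> collects what \<open>\<delta>\<close> must lie above: the point
    \<open>c\<close> separating the branches, the codes of elements, and the levels reached by the
    isomorphism and its inverse.\<close>
  define G where "G \<gamma> = insert c (code ` univ (tree \<gamma> E) \<union>
      ((\<lambda>u. lev E' (h u)) ` univ (tree \<gamma> E) \<union> (\<lambda>u. lev E (?k u)) ` univ (tree \<gamma> E')))" for \<gamma>
  have "\<exists>b\<in>Field \<kappa>. G \<gamma> \<subseteq> underS \<kappa> b" if \<gamma>: "\<gamma> \<in> Field \<kappa>" for \<gamma>
  proof (rule le_lam_bounded)
    show "G \<gamma> \<subseteq> Field \<kappa>"
      using c(1) code(1) lev hb kb(1) tU[OF \<gamma>] tb[OF \<gamma>] unfolding G_def by blast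
    have im: "|f ` univ (tree \<gamma> D)| \<le>o lam" for f :: "'a \<Rightarrow> 'l set" and D
      using card_of_image tlam[OF \<gamma>] ordLeq_transitive by blast
    have "\<not> finite (Field lam)" using lam(1) by (simp add: cinfinite_def)
    then show "|G \<gamma>| \<le>o lam"
      unfolding G_def using lam(1) im
      by (intro card_insert_le card_of_Un_ordLeq_infinite_Field) auto
  qed
  then obtain g where g: "\<And>\<gamma>. \<gamma> \<in> Field \<kappa> \<Longrightarrow> g \<gamma> \<in> Field \<kappa> \<and> G \<gamma> \<subseteq> underS \<kappa> (g \<gamma>)" by metis
  \<comment> \<open>The default \<open>e \<gamma>\<close> off the branch only keeps the last
    component inside \<open>U\<close>.\<close>
  define F where "F \<gamma> = (\<gamma> \<in> E, \<gamma> \<in> E', if e \<gamma> \<in> univ (branch E) then h (e \<gamma>) else e \<gamma>)" for \<gamma>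
  have bU: "univ (branch D) \<subseteq> U" for D unfolding branch(2) using tU by blast
  have "F ` Field \<kappa> \<subseteq> UNIV \<times> UNIV \<times> U"
    using bU hb e unfolding F_def bij_betw_def by fastforce
  then obtain \<delta> where \<delta>: "\<delta> \<in> Field \<kappa>" "cof_ge \<kappa> \<mu> \<delta>"
    and g\<delta>: "\<And>a. a \<in> underS \<kappa> \<delta> \<Longrightarrow> g a \<in> underS \<kappa> \<delta>"
    and F\<delta>: "\<And>a. a \<in> underS \<kappa> \<delta> \<Longrightarrow> guess \<delta> a = F a"
    using guess[of F g] g by blast
  have G\<delta>: "G \<gamma> \<subseteq> underS \<kappa> \<delta>" if "\<gamma> \<in> underS \<kappa> \<delta>" for \<gamma>
    using g[OF underS_Field[OF that]] g\<delta>[OF that] underS_trans[OF wo\<kappa>] underS_subset_under by fast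
  obtain \<gamma>0 where "\<gamma>0 \<in> underS \<kappa> \<delta>" using cof_ge_nonempty[OF \<mu>(1) \<delta>(2)] .
  then have c\<delta>: "c \<in> underS \<kappa> \<delta>" using G\<delta> unfolding G_def by blast
  have g1: "guess1 \<delta> = E \<inter> underS \<kappa> \<delta>" and g2: "guess2 \<delta> = E' \<inter> underS \<kappa> \<delta>"
    using F\<delta> by (auto simp: guess1_def guess2_def F_def)
  have ne: "guess1 \<delta> \<noteq> guess2 \<delta>" using c(2) c\<delta> unfolding g1 g2 by blast
  note ub = univ_base[OF \<delta>]
  let ?P = "base \<delta> E" and ?Q = "base \<delta> E'"
  have hh: "guess_map \<delta> u = h u" if u: "u \<in> univ ?P" for u
  proof -
    obtain \<beta> where \<beta>: "\<beta> \<in> underS \<kappa> \<delta>" "u \<in> univ (tree \<beta> E)" using u unfolding ub by blast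
    have "code u \<in> underS \<kappa> \<delta>" using G\<delta>[OF \<beta>(1)] \<beta>(2) unfolding G_def by blast
    moreover have "u \<in> univ (branch E)" using tb[OF underS_Field[OF \<beta>(1)]] \<beta>(2) by blast
    moreover have "e (code u) = u" using bU calculation(2) code(2) by blast
    ultimately show ?thesis using F\<delta> by (simp add: guess_map_def F_def)
  qed
  \<comment> \<open>By the choice of \<open>\<delta>\<close> both bases are unions of the earlier
    levels, and levels below \<open>\<delta>\<close> are carried to levels below
    \<open>\<delta>\<close> in both directions.\<close>
  have "h ` univ ?P = univ ?Q"
  proof
    show "h ` univ ?P \<subseteq> univ ?Q"
    proof
      fix v assume "v \<in> h ` univ ?P"
      then obtain \<beta> u where \<beta>: "\<beta> \<in> underS \<kappa> \<delta>" "u \<in> univ (tree \<beta> E)" "v = h u"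
        unfolding ub by blast
      then have "lev E' v \<in> underS \<kappa> \<delta>" using G\<delta>[OF \<beta>(1)] unfolding G_def by blast
      moreover have "v \<in> univ (tree (lev E' v) E')"
        using lev hb tb[OF underS_Field[OF \<beta>(1)]] \<beta>(2,3) by blast
      ultimately show "v \<in> univ ?Q" unfolding ub by blast
    qed
    show "univ ?Q \<subseteq> h ` univ ?P"
    proof
      fix v assume "v \<in> univ ?Q"
      then obtain \<beta> where \<beta>: "\<beta> \<in> underS \<kappa> \<delta>" "v \<in> univ (tree \<beta> E')" unfolding ub by blast
      then have "lev E (?k v) \<in> underS \<kappa> \<delta>" using G\<delta>[OF \<beta>(1)] unfolding G_def by blast
      moreover have v: "v \<in> univ (branch E')" using tb[OF underS_Field[OF \<beta>(1)]] \<beta>(2) by blast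
      moreover have "?k v \<in> univ (tree (lev E (?k v)) E)" using lev[OF kb(1)[OF v]] by blast
      ultimately have "?k v \<in> univ ?P" unfolding ub by blast
      then show "v \<in> h ` univ ?P" using kb(2)[OF v] by (metis imageI)
    qed
  qed
  moreover have "(?P, branch E) \<in> Le K" "(?Q, branch E') \<in> Le K"
    using tree_chain[OF \<delta>(1)] branch(3)[OF \<delta>(1)] Le_trans[OF ac] unfolding proper_ext_def by blast+
  ultimately have "iso \<mu> L h ?P ?Q"
    using iso_restrict[OF h] Le_ModD(3)[OF ac] by blast
  then have iso: "iso \<mu> L (guess_map \<delta>) ?P ?Q" using hh iso_cong by metis
  then have active: "guess_active \<delta> (base \<delta>)"
    using ne by (simp add: guess_active_def g1 g2 base_restrict)
  \<comment> \<open>The guess is correct and active, so the two branches leave level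
    \<open>\<delta>\<close> by the two halves of a non-amalgamable pair.\<close>
  have "split_pair (guess_map \<delta>) ?P ?Q = (tree \<delta> E, tree \<delta> E')"
    using active ne unfolding tree_eq[of \<delta>] next_model_def g1[symmetric] g2[symmetric]
    by (simp add: g1 g2 base_restrict)
  then have na: "non_amalgamable (guess_map \<delta>) ?P (tree \<delta> E) (tree \<delta> E')"
    using split_pair(3)[OF _ _ iso] tree_chain[OF \<delta>(1)] by blast
  obtain A where A: "iso \<mu> L h (tree \<delta> E) A" "(A, branch E') \<in> Le K"
    using iso_Le[OF ac branch(3)[OF \<delta>(1)] h] .
  have Au: "univ A = h ` univ (tree \<delta> E)" using iso_strucD(5)[OF A(1)] by simp
  have AE': "univ A \<subseteq> univ (branch E')" using Le_ModD(4)[OF ac A(2)] .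
  \<comment> \<open>The image of \<open>tree \<delta> E\<close> under \<open>h\<close> has at most
    \<open>lam\<close> elements, so one level \<open>b\<close> above \<open>\<delta>\<close> of the
    branch \<open>E'\<close> contains it.\<close>
  have "\<exists>b\<in>Field \<kappa>. insert \<delta> (lev E' ` univ A) \<subseteq> underS \<kappa> b"
  proof (rule le_lam_bounded)
    show "insert \<delta> (lev E' ` univ A) \<subseteq> Field \<kappa>" using \<delta>(1) lev AE' by blast
    have "|lev E' ` univ A| \<le>o lam"
      unfolding Au image_image using card_of_image tlam[OF \<delta>(1)] ordLeq_transitive by blast
    then show "|insert \<delta> (lev E' ` univ A)| \<le>o lam" by (rule card_insert_le[OF lam(1)])
  qed
  then obtain b where b: "b \<in> Field \<kappa>" "\<delta> \<in> underS \<kappa> b" "\<And>u. u \<in> univ A \<Longrightarrow> lev E' u \<in> underS \<kappa> b"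
    by blast
  let ?N = "tree b E'"
  have "u \<in> univ ?N" if "u \<in> univ A" for u
  proof -
    have "(tree (lev E' u) E', ?N) \<in> Le K" using tree_chain[OF b(1)] b(3)[OF that] by blast
    then show ?thesis using lev[of u E'] AE' that Le_ModD(4)[OF ac] by blast
  qed
  then have "substruc \<mu> L A ?N"
    using substruc_subset Le_ModD(3)[OF ac] A(2) branch(3)[OF b(1)] by blast
  \<comment> \<open>Both models are strong in \<open>branch E'\<close>, so coherence applies. Now
    \<open>h\<close> and the identity amalgamate the pair inside \<open>?N\<close>.\<close>
  then have "(A, ?N) \<in> Le K"
    using coh A(2) branch(3)[OF b(1)] Le_ModD(1,2)[OF ac] unfolding coherence_def by blast
  then have "K_embedding \<mu> K h (tree \<delta> E) ?N" using A(1) unfolding K_embedding_def by blast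
  moreover have "K_embedding \<mu> K (\<lambda>x. x) (tree \<delta> E') ?N"
    using tree_chain[OF b(1)] b(2) by (intro K_embedding_id[OF ac]) blast
  moreover have "?N \<in> Mod_card K lam" using tree_chain[OF b(1)] small_modelsD(1) by blast
  ultimately show False using na hh unfolding non_amalgamable_def by metis
qed

section \<open>Counting the models of cardinality \<open>\<kappa>\<close>\<close>

lemma many_models: "ctwo ^c \<kappa> \<le>o num_models \<mu> \<kappa> K"
proof -
  let ?R = "iso_rel \<mu> K \<inter> Mod_card K \<kappa> \<times> Mod_card K \<kappa>"
  have "inj_on (\<lambda>E. ?R `` {branch E}) (Pow (Field \<kappa>))"
  proof (rule inj_onI)
    fix E E' assume *: "E \<in> Pow (Field \<kappa>)" "E' \<in> Pow (Field \<kappa>)" "?R `` {branch E} = ?R `` {branch E'}"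
    have "branch E' \<in> ?R `` {branch E'}"
      using branch_card iso_id[OF Mod_is_struc[OF ac branch(1)]] by (auto simp: iso_rel_def)
    then have "(branch E, branch E') \<in> ?R" using *(3) by blast
    then obtain h where "iso \<mu> L h (branch E) (branch E')" by (auto simp: iso_rel_def)
    then show "E = E'" using branch_not_iso * by blast
  qed
  moreover have "(\<lambda>E. ?R `` {branch E}) ` Pow (Field \<kappa>) \<subseteq> Mod_card K \<kappa> // ?R"
    using branch_card by (auto simp: quotient_def)
  ultimately have "|Pow (Field \<kappa>)| \<le>o num_models \<mu> \<kappa> K"
    unfolding num_models_def using card_of_ordLeq by blast
  moreover have "|Pow (Field \<kappa>)| =o ctwo ^c \<kappa>"
    unfolding ctwo_def cexp_def Field_card_of by (rule card_of_Pow_Func)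
  ultimately show ?thesis using ordIso_symmetric ordIso_ordLeq_trans by blast
qed

end

context failed_amalgamation
begin

lemma many_models: "ctwo ^c \<kappa> \<le>o num_models \<mu> \<kappa> K"
proof -
  have "|Field \<kappa>| =o |U|"
    using \<kappa>(1) card_of_Field_ordIso U ordIso_symmetric ordIso_transitive by blast
  then obtain e where e: "bij_betw e (Field \<kappa>) U" using card_of_ordIso by blast
  \<comment> \<open>The list of partial functions in the diamond needs
    \<open>\<kappa> ^c lam \<le>o \<kappa>\<close>; this follows from writing
    \<open>\<kappa>\<close> as \<open>ctwo ^c lam\<close>.\<close>
  have "\<kappa> ^c lam =o (ctwo ^c lam) ^c lam"
    using lam(1,4) ordIso_symmetric by (blast intro: cexp_cong1)
  also have "(ctwo ^c lam) ^c lam =o ctwo ^c lam"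
    using lam(1) Cinfinite_Cnotzero by (intro cexp_cprod_ordLeq Card_order_ctwo ordLeq_refl) auto
  also have "ctwo ^c lam =o \<kappa>" by (rule lam(4))
  finally have pow: "\<kappa> ^c lam \<le>o \<kappa>" by (rule ordIso_imp_ordLeq)
  have inf: "\<not> finite (Field \<kappa>)" using \<kappa>(1) by (simp add: cinfinite_def)
  have bool: "|UNIV :: bool set| \<le>o \<kappa>"
    using ordLess_imp_ordLeq[OF ctwo_ordLess_Cinfinite[OF \<kappa>(1)]] by (simp add: ctwo_def)
  \<comment> \<open>One guessed value carries membership in each of two branches and a value of the
    map between them.\<close>
  have "|(UNIV :: bool set) \<times> (UNIV :: bool set) \<times> U| \<le>o \<kappa>"
    using bool ordIso_imp_ordLeq[OF U] \<kappa>(1)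
    by (intro card_of_Times_ordLeq_infinite_Field[OF inf]) auto
  from gregory_diamond[OF \<mu> \<kappa> lam(1,2) lam_less lam(3) below pow this]
  obtain guess :: "'l set \<Rightarrow> 'l set \<Rightarrow> bool \<times> bool \<times> 'a" where
    "\<And>F g. F ` Field \<kappa> \<subseteq> UNIV \<times> UNIV \<times> U \<Longrightarrow> g ` Field \<kappa> \<subseteq> Field \<kappa> \<Longrightarrow>
       \<exists>\<delta>\<in>Field \<kappa>. cof_ge \<kappa> \<mu> \<delta> \<and> (\<forall>a\<in>underS \<kappa> \<delta>. g a \<in> underS \<kappa> \<delta> \<and> guess \<delta> a = F a)"
    by blast
  then interpret guessed_tree \<mu> K lam U guess e
    by unfold_locales (use e in auto)
  show ?thesis by (rule many_models)
qed

end

section \<open>Consequences of the hypotheses, and the conclusion\<close>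

lemma cpow_less_absorb:
  fixes \<mu> :: "'m rel" and lam :: "'l rel"
  assumes "Cinfinite \<mu>" "Card_order lam" "lam =o cpow_less lam \<mu>"
  shows "\<mu> \<le>o lam" "Cinfinite lam"
proof -
  let ?S = "SIGMA a : Field \<mu>. underS \<mu> a \<rightarrow>\<^sub>E Field lam"
  have wo: "Well_order \<mu>" using assms(1) by (auto simp: card_order_on_def)
  have S: "|?S| =o lam" using assms(3) ordIso_symmetric by (auto simp: cpow_less_def)
  \<comment> \<open>The least length admits only the empty sequence, which exists over any base;
    this rules out that \<open>lam\<close> is 0.\<close>
  obtain a where a: "a \<in> Field \<mu>" "\<And>b. (b, a) \<in> \<mu> - Id \<Longrightarrow> b \<notin> Field \<mu>"
    using wfE_min[OF wf_strict[OF wo]] assms(1)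
    by (metis cinfinite_def finite.emptyI ex_in_conv)
  have "underS \<mu> a = {}" using a(2) by (auto simp: underS_def Field_def)
  then have "(a, \<lambda>_. undefined) \<in> ?S" using a(1) by simp
  then have "?S \<noteq> {}" by blast
  moreover have "|?S| =o |Field lam|"
    using S assms(2) card_of_Field_ordIso ordIso_symmetric ordIso_transitive by blast
  ultimately have "Field lam \<noteq> {}" using card_of_empty3 ordIso_imp_ordLeq by fastforce
  then obtain l where l: "l \<in> Field lam" by blast
  \<comment> \<open>One constant sequence for each length below \<open>\<mu>\<close> already gives
    \<open>\<mu>\<close> many sequences.\<close>
  have "inj_on (\<lambda>a. (a, \<lambda>_\<in>underS \<mu> a. l)) (Field \<mu>)" by (auto simp: inj_on_def)
  moreover have "(\<lambda>a. (a, \<lambda>_\<in>underS \<mu> a. l)) ` Field \<mu> \<subseteq> ?S" using l by auto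
  ultimately have "|Field \<mu>| \<le>o |?S|" using card_of_ordLeq by blast
  moreover have "\<mu> =o |Field \<mu>|" using assms(1) card_of_Field_ordIso ordIso_symmetric by blast
  ultimately show "\<mu> \<le>o lam"
    using S ordIso_ordLeq_trans ordLeq_ordIso_trans by blast
  then show "Cinfinite lam" using assms(1,2) cinfinite_mono by blast
qed

lemma num_models_cone_iso:
  assumes ac: "mu_abstract_class \<mu> K" and one: "num_models \<mu> \<chi> K =o cone"
    and "M \<in> Mod_card K \<chi>" "N \<in> Mod_card K \<chi>"
  shows "\<exists>h. iso \<mu> (Lang K) h M N"
proof -
  let ?R = "iso_rel \<mu> K \<inter> Mod_card K \<chi> \<times> Mod_card K \<chi>"
  obtain f where f: "bij_betw f (Mod_card K \<chi> // ?R) {()}"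
    using one card_of_ordIso[of "Mod_card K \<chi> // ?R" "{()}"]
    unfolding num_models_def cone_def by blast
  have "?R `` {M} = ?R `` {N}"
    using assms(3,4) by (intro inj_onD[OF bij_betw_imp_inj_on[OF f]]) (auto intro: quotientI)
  moreover have "N \<in> ?R `` {N}"
    using assms(4) iso_id[OF Mod_is_struc[OF ac, of N]] by (auto simp: iso_rel_def Mod_card_def)
  ultimately have "(M, N) \<in> ?R" by blast
  then show ?thesis by (auto simp: iso_rel_def)
qed

theorem theorem6p12:
  fixes \<mu> :: "'m rel"
    and K :: "('a, 'f, 'r, 'm) aclass"
    and lam :: "'l rel"
  assumes "Cinfinite \<mu>" and "regularCard \<mu>"
    and "mu_AEC \<mu> K"
    and "Card_order lam"
    and "lam =o cpow_less lam \<mu>"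
    and "LS \<mu> K \<le>o lam"
    and "num_models \<mu> lam K =o cone"
    and "cone \<le>o num_models \<mu> (cardSuc lam) K"
    and "num_models \<mu> (cardSuc lam) K <o ctwo ^c cardSuc lam"
    and "\<forall>\<delta> :: 'l set rel. Well_order \<delta> \<and> \<delta> <o cardSuc lam \<longrightarrow> chain_extension K lam \<delta>"
    and "lam =o lam ^c \<mu>"
    and "ctwo ^c lam =o cardSuc lam"
  shows "amalgamation \<mu> K lam"
proof (rule ccontr)
  assume na: "\<not> amalgamation \<mu> K lam"
  have ac: "mu_abstract_class \<mu> K" using assms(3) by (simp add: mu_AEC_def)
  \<comment> \<open>The universe of a model of cardinality \<open>cardSuc lam\<close> will serve as
    \<open>U\<close>; the lower bound on the number of such models provides one.\<close>
  have "Mod_card K (cardSuc lam) \<noteq> {}"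
  proof
    assume "Mod_card K (cardSuc lam) = {}"
    then have "|{()}| \<le>o |{} :: ('a, 'f, 'r, 'm) struc set set|"
      using assms(8) by (simp add: num_models_def cone_def)
    then show False using card_of_empty3 by blast
  qed
  then obtain M where "M \<in> Mod_card K (cardSuc lam)" by blast
  then interpret failed_amalgamation \<mu> K lam "univ M"
    using assms na ac cpow_less_absorb[OF assms(1,4,5)] num_models_cone_iso[OF ac assms(7)]
      ordIso_imp_ordLeq[OF ordIso_symmetric[OF assms(11)]]
    by unfold_locales (auto simp: mu_AEC_def Mod_card_def)
  show False using many_models assms(9) not_ordLess_ordLeq by blast
qed

end
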